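(* Let $0\le\alpha<\infty$ and $C>0$, let $D\subset\mathbb{C}$ be a domain, and let $\mathcal{F}_{\alpha,C}(D)$ be the family of all meromorphic functions $f$ in $D$ such that $$\frac{|f'(z)|}{1+|f(z)|^{\alpha}}>C\quad\text{for every } z\in D.$$ Then the following hold: (1) If $\alpha>1$, then $\mathcal{F}_{\alpha,C}(D)$ is normal in $D$. (2) If $\alpha=1$, then $\mathcal{F}_{\alpha,C}(D)$ is quasi-normal in $D$, but not necessarily normal (that is, $\mathcal{F}_{1,C}(D)$ is quasi-normal for every domain $D$ and every $C>0$, and there exist a domain $D$ and a $C>0$ for which $\mathcal{F}_{1,C}(D)$ is not normal in $D$).
   Context: A domain is a nonempty connected open subset of $\mathbb{C}$. Meromorphic functions on $D$ are regarded as maps into the Riemann sphere $\hat{\mathbb{C}}$ with the spherical (chordal) metric $\chi$. At a pole $z_0$ of $f$, the value of $|f'(z)|/(1+|f(z)|^{\alpha})$ is understood as its limit in $[0,+\infty]$ as $z\to z_0$. A family $\mathcal{F}$ of functions meromorphic in $D$ is normal in $D$ if every sequence in $\mathcal{F}$ has a subsequence converging with respect to $\chi$ uniformly on compact subsets of $D$ (the limit is then a meromorphic function on $D$ or identically $\infty$). The family $\mathcal{F}$ is quasi-normal in $D$ if every sequence in $\mathcal{F}$ has a subsequence for which there is a set $E\subset D$ with no accumulation points in $D$ such that the subsequence converges with respect to $\chi$ uniformly on compact subsets of $D\setminus E$. The set $E$ may depend on the subsequence. *)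

theory Defs
  imports "HOL-Complex_Analysis.Complex_Analysis"
begin

text \<open>
  The Riemann sphere is \<^typ>\<open>complex option\<close>, with \<^term>\<open>None\<close> as the point at infinity.
\<close>
type_synonym riemann_sphere = "complex option"

definition complex_domain :: "complex set \<Rightarrow> bool" where
  "complex_domain D \<longleftrightarrow> open D \<and> connected D \<and> D \<noteq> {}"

fun chordal :: "riemann_sphere \<Rightarrow> riemann_sphere \<Rightarrow> real" where
  "chordal (Some z) (Some w) = norm (z - w) / (sqrt (1 + (norm z)\<^sup>2) * sqrt (1 + (norm w)\<^sup>2))"
| "chordal (Some z) None = 1 / sqrt (1 + (norm z)\<^sup>2)"
| "chordal None (Some w) = 1 / sqrt (1 + (norm w)\<^sup>2)"
| "chordal None None = 0"

text \<open>
  A meromorphic function on \<open>D\<close> is represented by a function \<open>f\<close> that is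
  \<open>nicely_meromorphic_on D\<close>: it is continuous (hence holomorphic) at every point of \<open>D\<close> that is
  not a pole, and it has the dummy value \<open>0\<close> at its poles. The following is the map into the
  Riemann sphere that it represents.
\<close>
definition to_sphere :: "(complex \<Rightarrow> complex) \<Rightarrow> complex \<Rightarrow> riemann_sphere" where
  "to_sphere f z = (if is_pole f z then None else Some (f z))"

text \<open>
  Note \<open>0 powr 0 = 0\<close>; the case distinction ensures \<open>\<bar>f z\<bar>\<^sup>0 = 1\<close> also at zeros of \<open>f\<close>.
\<close>
definition deriv_quotient :: "real \<Rightarrow> (complex \<Rightarrow> complex) \<Rightarrow> complex \<Rightarrow> real" where
  "deriv_quotient \<alpha> f z =
     norm (deriv f z) / (1 + (if \<alpha> = 0 then 1 else norm (f z) powr \<alpha>))"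

text \<open>
  The quotient as an element of \<open>[0, \<infinity>]\<close>, with its limiting value at the poles.
\<close>
definition ext_deriv_quotient :: "real \<Rightarrow> (complex \<Rightarrow> complex) \<Rightarrow> complex \<Rightarrow> ereal" where
  "ext_deriv_quotient \<alpha> f z =
     (if is_pole f z then Lim (at z) (\<lambda>w. ereal (deriv_quotient \<alpha> f w))
      else ereal (deriv_quotient \<alpha> f z))"

definition deriv_family :: "real \<Rightarrow> real \<Rightarrow> complex set \<Rightarrow> (complex \<Rightarrow> complex) set" where
  "deriv_family \<alpha> C D =
     {f. f nicely_meromorphic_on D \<and> (\<forall>z\<in>D. ext_deriv_quotient \<alpha> f z > ereal C)}"

definition chordally_convergent_on :: "complex set \<Rightarrow> (nat \<Rightarrow> complex \<Rightarrow> complex) \<Rightarrow> bool" where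
  "chordally_convergent_on U s \<longleftrightarrow>
     (\<exists>g :: complex \<Rightarrow> riemann_sphere. \<forall>K. compact K \<and> K \<subseteq> U \<longrightarrow>
        uniform_limit K (\<lambda>n z. chordal (to_sphere (s n) z) (g z)) (\<lambda>_. 0) sequentially)"

definition normal_family :: "(complex \<Rightarrow> complex) set \<Rightarrow> complex set \<Rightarrow> bool" where
  "normal_family \<F> D \<longleftrightarrow>
     (\<forall>s :: nat \<Rightarrow> complex \<Rightarrow> complex. range s \<subseteq> \<F> \<longrightarrow>
        (\<exists>r :: nat \<Rightarrow> nat. strict_mono r \<and> chordally_convergent_on D (s \<circ> r)))"

definition quasi_normal_family :: "(complex \<Rightarrow> complex) set \<Rightarrow> complex set \<Rightarrow> bool" where
  "quasi_normal_family \<F> D \<longleftrightarrow>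
     (\<forall>s :: nat \<Rightarrow> complex \<Rightarrow> complex. range s \<subseteq> \<F> \<longrightarrow>
        (\<exists>(r :: nat \<Rightarrow> nat) E. strict_mono r \<and> E \<subseteq> D \<and> (\<forall>z\<in>D. \<not> z islimpt E) \<and>
           chordally_convergent_on (D - E) (s \<circ> r)))"

end

theory Submission
  imports Defs
begin

text \<open>
  The idea is to replace a member \<open>f\<close> of the family, for \<open>\<alpha> \<ge> 1\<close>, by the pair \<open>u = 1 / f'\<close>, \<open>v = f / f'\<close>. The
  differential inequality says that \<open>f'\<close> has no zeros and that both functions are bounded by
  \<open>2 / C\<close>; at the poles of \<open>f\<close> both extend holomorphically by \<open>0\<close>. As \<open>f = v / u\<close>, the pair gives
  homogeneous coordinates of \<open>f\<close> that are bounded holomorphic functions. By Montel's theorem every sequence \<open>f\<^sub>n\<close> in the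
  family has a subsequence for which \<open>u\<^sub>n\<close> and \<open>v\<^sub>n\<close> converge locally uniformly, to \<open>u\<close> and \<open>v\<close> say, and
  then \<open>f\<^sub>n\<close> converges chordally to \<open>v / u\<close> near every point that is not a common zero of \<open>u\<close> and \<open>v\<close>.

  Common zeros are handled by the relation \<open>v' u - v u' = u\<close>, which expresses \<open>(v / u)' = 1 / u\<close> and
  is inherited by the limits, and by its consequence that \<open>v\<^sub>n' = 1\<close> at every zero of \<open>f\<^sub>n\<close>.

  If \<open>u\<close> is not identically \<open>0\<close> and \<open>u a = 0\<close>, the relation gives \<open>v' a \<noteq> 1\<close> (lemma
  \<open>wronskian_solution_at_zero\<close>). So for large \<open>n\<close> there are no zeros of \<open>f\<^sub>n\<close> near \<open>a\<close>, the functions \<open>1 / f\<^sub>n\<close> are holomorphic there,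
  and their convergence to \<open>u / v\<close> on a small circle spreads to the disc by the maximum principle.

  If \<open>u\<close> and \<open>v\<close> both vanish identically, then \<open>v\<^sub>n' \<rightarrow> 0\<close>, and again \<open>f\<^sub>n\<close> has no zeros near a given point for
  large \<open>n\<close>. But \<open>|f\<^sub>n'|\<close> tends
  to infinity, and a function with \<open>|f'| \<ge> L\<close> on a disc of radius \<open>\<delta>\<close> and without zeros there has
  modulus at least \<open>L \<delta>\<close> at the centre (lemma \<open>norm_le_of_Riccati_inequality\<close>). Hence \<open>f\<^sub>n \<rightarrow> \<infinity>\<close> locally uniformly.

  So normality can fail only if \<open>u\<close> vanishes identically and \<open>v\<close> does not. Then \<open>f\<^sub>n \<rightarrow> \<infinity>\<close> away from the
  zeros of \<open>v\<close>, which have no accumulation point in \<open>D\<close>; this gives quasi-normality.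
  If \<open>\<alpha> > 1\<close>, this case does not occur, because the inequality also yields
  \<open>|v| powr \<alpha> \<le> |u| powr (\<alpha> - 1) / C\<close>. For \<open>\<alpha> = 1\<close> it does occur: for \<open>f\<^sub>n z = n z\<close> on the unit disc
  one has \<open>u\<^sub>n = 1 / n\<close> and \<open>v\<^sub>n z = z\<close>, and the sequence is not normal at \<open>0\<close>.
\<close>

section \<open>Homogeneous coordinates on the sphere and chordal convergence\<close>

text \<open>
  The point of the Riemann sphere with homogeneous coordinates \<open>[v : u]\<close>. The pair \<open>(0, 0)\<close> is sent
  to \<open>\<infinity>\<close>. This default is used below: wherever convergence is shown at a common zero of the limit
  coordinates, the limit is \<open>\<infinity>\<close>.
\<close>

definition ratio :: "complex \<Rightarrow> complex \<Rightarrow> riemann_sphere" where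
  "ratio v u = (if u = 0 then None else Some (v / u))"

lemma chordal_ratio:
  assumes "v \<noteq> 0 \<or> u \<noteq> 0" "v' \<noteq> 0 \<or> u' \<noteq> 0"
  shows "chordal (ratio v u) (ratio v' u') =
    norm (v * u' - v' * u) / (sqrt ((norm v)\<^sup>2 + (norm u)\<^sup>2) * sqrt ((norm v')\<^sup>2 + (norm u')\<^sup>2))"
proof -
  have scale: "sqrt (1 + (norm a / norm b)\<^sup>2) = sqrt ((norm a)\<^sup>2 + (norm b)\<^sup>2) / norm b"
    if "b \<noteq> 0" for a b :: complex
  proof -
    have "1 + (norm a / norm b)\<^sup>2 = ((norm a)\<^sup>2 + (norm b)\<^sup>2) / (norm b)\<^sup>2"
      using that by (simp add: field_simps)
    then show ?thesis by (simp add: real_sqrt_divide)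
  qed
  consider "u = 0" "u' = 0" | "u = 0" "u' \<noteq> 0" | "u \<noteq> 0" "u' = 0" | "u \<noteq> 0" "u' \<noteq> 0" by blast
  then show ?thesis
  proof cases
    case 4
    have "v / u - v' / u' = (v * u' - v' * u) / (u * u')"
      using 4 by (simp add: field_simps)
    then show ?thesis
      using 4 by (simp add: ratio_def scale norm_divide norm_mult)
  qed (use assms in \<open>auto simp: ratio_def scale norm_mult norm_divide\<close>)
qed

text \<open>
  The chordal distance does not see a common factor of the coordinates, so convergence of the
  coordinates gives chordal convergence with an error controlled by the size of the limit pair only.
\<close>
lemma chordal_ratio_le:
  assumes "v \<noteq> 0 \<or> u \<noteq> 0" "v' \<noteq> 0 \<or> u' \<noteq> 0"
  shows "chordal (ratio v u) (ratio v' u') \<le>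
    (norm (v - v') + norm (u - u')) / sqrt ((norm v')\<^sup>2 + (norm u')\<^sup>2)"
proof -
  define S where "S = sqrt ((norm v)\<^sup>2 + (norm u)\<^sup>2)"
  have S: "norm v \<le> S" "norm u \<le> S" "S > 0"
    using assms(1) by (auto simp: S_def add_pos_nonneg add_nonneg_pos)
  have "v * u' - v' * u = u * (v - v') - v * (u - u')"
    by (simp add: algebra_simps)
  then have "norm (v * u' - v' * u) \<le> norm u * norm (v - v') + norm v * norm (u - u')"
    by (metis norm_mult norm_triangle_ineq4)
  also have "\<dots> \<le> S * norm (v - v') + S * norm (u - u')"
    using S by (intro add_mono mult_right_mono) auto
  finally have "norm (v * u' - v' * u) / S \<le> norm (v - v') + norm (u - u')"
    using S by (simp add: field_simps)
  then have "norm (v * u' - v' * u) / S / sqrt ((norm v')\<^sup>2 + (norm u')\<^sup>2)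
      \<le> (norm (v - v') + norm (u - u')) / sqrt ((norm v')\<^sup>2 + (norm u')\<^sup>2)"
    by (rule divide_right_mono) simp
  then show ?thesis
    by (simp add: chordal_ratio[OF assms] S_def)
qed

lemma chordal_nonneg: "chordal x y \<ge> 0"
  by (cases "(x, y)" rule: chordal.cases) auto

text \<open>
  The two kinds of charts, around finite points and around \<open>\<infinity>\<close>, are treated at once: it suffices
  that the limit coordinates have no common zero.
\<close>
lemma uniform_limit_chordal_ratio:
  assumes K: "compact K" "continuous_on K v" "continuous_on K u"
    and nz: "\<And>z. z \<in> K \<Longrightarrow> v z \<noteq> 0 \<or> u z \<noteq> 0"
    and lim: "uniform_limit K V v sequentially" "uniform_limit K U u sequentially"
  shows "uniform_limit K (\<lambda>n z. chordal (ratio (V n z) (U n z)) (ratio (v z) (u z))) (\<lambda>_. 0) sequentially"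
proof (cases "K = {}")
  case False
  define h where "h z = sqrt ((norm (v z))\<^sup>2 + (norm (u z))\<^sup>2)" for z
  have "continuous_on K h"
    unfolding h_def by (intro continuous_intros K)
  then obtain z0 where z0: "z0 \<in> K" "\<And>z. z \<in> K \<Longrightarrow> h z0 \<le> h z"
    using continuous_attains_inf[OF K(1) False] by metis
  define m where "m = h z0"
  have m: "m > 0" "\<And>z. z \<in> K \<Longrightarrow> m \<le> h z"
    using z0 nz[OF z0(1)] by (auto simp: m_def h_def add_pos_nonneg add_nonneg_pos)
  show ?thesis
  proof (rule uniform_limitI)
    fix e :: real assume "e > 0"
    define d where "d = min (m / 2) (e * m / 2)"
    have d: "d > 0" "d \<le> m / 2" "2 * d \<le> e * m"
      using \<open>e > 0\<close> m by (auto simp: d_def)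
    show "\<forall>\<^sub>F n in sequentially. \<forall>z\<in>K.
        dist (chordal (ratio (V n z) (U n z)) (ratio (v z) (u z))) 0 < e"
      using uniform_limitD[OF lim(1) d(1)] uniform_limitD[OF lim(2) d(1)]
    proof eventually_elim
      case (elim n)
      show ?case
      proof
        fix z assume z: "z \<in> K"
        have near: "norm (V n z - v z) < d" "norm (U n z - u z) < d"
          using elim z by (auto simp: dist_norm)
        have "V n z \<noteq> 0 \<or> U n z \<noteq> 0"
        proof (rule ccontr)
          assume "\<not> ?thesis"
          then have "norm (v z) < d" "norm (u z) < d" using near by auto
          moreover have "h z \<le> norm (v z) + norm (u z)"
            unfolding h_def by (rule sqrt_sum_squares_le_sum) auto
          ultimately show False using m(2)[OF z] d by linarith
        qed
        then have "chordal (ratio (V n z) (U n z)) (ratio (v z) (u z))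
            \<le> (norm (V n z - v z) + norm (U n z - u z)) / h z"
          unfolding h_def by (rule chordal_ratio_le) (use nz z in auto)
        also have "\<dots> < 2 * d / h z"
          using near m(1) m(2)[OF z] by (intro divide_strict_right_mono) auto
        also have "\<dots> \<le> 2 * d / m"
          using m(1) m(2)[OF z] d by (intro divide_left_mono mult_pos_pos) auto
        also have "\<dots> \<le> e"
          using d m by (simp add: field_simps)
        finally show "dist (chordal (ratio (V n z) (U n z)) (ratio (v z) (u z))) 0 < e"
          using chordal_nonneg by (simp add: dist_norm)
      qed
    qed
  qed
qed auto

text \<open>
  Chordal convergence may be checked locally. The limit \<open>g\<close> is fixed in advance, so that no gluing of
  local limits is needed.
\<close>
lemma chordally_convergent_onI:
  assumes "\<And>a. a \<in> U \<Longrightarrow> \<exists>r>0. uniform_limit (cball a r) (\<lambda>n z. chordal (to_sphere (s n) z) (g z)) (\<lambda>_. 0) sequentially"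
  shows "chordally_convergent_on U s"
  unfolding chordally_convergent_on_def
proof (intro exI allI impI)
  fix K assume K: "compact K \<and> K \<subseteq> U"
  have "\<forall>a\<in>U. \<exists>r. r > 0 \<and> uniform_limit (cball a r) (\<lambda>n z. chordal (to_sphere (s n) z) (g z)) (\<lambda>_. 0) sequentially"
    using assms by blast
  from bchoice[OF this] obtain r where r: "\<And>a. a \<in> U \<Longrightarrow> r a > 0 \<and>
      uniform_limit (cball a (r a)) (\<lambda>n z. chordal (to_sphere (s n) z) (g z)) (\<lambda>_. 0) sequentially"
    by blast
  have "K \<subseteq> (\<Union>a\<in>K. ball a (r a))"
  proof
    fix a assume "a \<in> K"
    with K r have "a \<in> ball a (r a)" by auto
    with \<open>a \<in> K\<close> show "a \<in> (\<Union>a\<in>K. ball a (r a))" by blast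
  qed
  then obtain J where J: "J \<subseteq> K" "finite J" "K \<subseteq> (\<Union>a\<in>J. ball a (r a))"
    using K compactE_image[of K K "\<lambda>a. ball a (r a)"] by auto
  have "uniform_limit (\<Union>a\<in>J. cball a (r a)) (\<lambda>n z. chordal (to_sphere (s n) z) (g z)) (\<lambda>_. 0) sequentially"
    by (rule uniform_limit_on_UNION) (use J K r in auto)
  moreover have "K \<subseteq> (\<Union>a\<in>J. cball a (r a))"
    by (rule order_trans[OF J(3)], rule UN_mono) auto
  ultimately show "uniform_limit K (\<lambda>n z. chordal (to_sphere (s n) z) (g z)) (\<lambda>_. 0) sequentially"
    by (rule uniform_limit_on_subset)
qed

section \<open>Uniform limits of holomorphic functions\<close>

text \<open>Cauchy's estimate on discs of radius \<open>(R - r) / 2\<close> around the points of the smaller disc.\<close>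

lemma uniform_limit_deriv_cball:
  assumes "R > r" "r \<ge> 0" and holo: "\<And>n. F n holomorphic_on ball a R" "f holomorphic_on ball a R"
    and lim: "uniform_limit (ball a R) F f sequentially"
  shows "uniform_limit (cball a r) (\<lambda>n. deriv (F n)) (deriv f) sequentially"
proof (rule uniform_limitI)
  fix e :: real assume "e > 0"
  define d where "d = (R - r) / 2"
  have d: "d > 0" "d < R - r" using assms by (auto simp: d_def)
  have "\<forall>\<^sub>F n in sequentially. \<forall>z\<in>ball a R. dist (F n z) (f z) < e * d / 2"
    using lim \<open>e > 0\<close> d by (intro uniform_limitD) auto
  then show "\<forall>\<^sub>F n in sequentially. \<forall>z\<in>cball a r. dist (deriv (F n) z) (deriv f z) < e"
  proof eventually_elim
    case (elim n)
    show ?case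
    proof
      fix z assume z: "z \<in> cball a r"
      have sub: "cball z d \<subseteq> ball a R"
      proof
        fix w assume "w \<in> cball z d"
        then show "w \<in> ball a R"
          using z d dist_triangle[of a w z] by simp
      qed
      have "norm ((deriv ^^ 1) (\<lambda>z. F n z - f z) z) \<le> fact 1 * (e * d / 2) / d ^ 1"
      proof (rule Cauchy_inequality)
        have holo': "(\<lambda>z. F n z - f z) holomorphic_on cball z d"
          using holo sub by (intro holomorphic_intros) (auto intro: holomorphic_on_subset)
        show "(\<lambda>z. F n z - f z) holomorphic_on ball z d"
          using holo' by (rule holomorphic_on_subset) auto
        show "continuous_on (cball z d) (\<lambda>z. F n z - f z)"
          using holo' by (rule holomorphic_on_imp_continuous_on)
        show "norm (F n x - f x) \<le> e * d / 2" if "norm (z - x) = d" for x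
        proof -
          have "x \<in> ball a R" using that sub by (auto simp: dist_norm)
          then show ?thesis using elim by (auto simp: dist_norm less_imp_le)
        qed
      qed (use d in auto)
      moreover have "deriv (\<lambda>z. F n z - f z) z = deriv (F n) z - deriv f z"
      proof -
        have "z \<in> ball a R" using subsetD[OF sub, of z] d by auto
        then show ?thesis
          using holo by (intro deriv_diff) (auto intro: holomorphic_on_imp_differentiable_at[of _ "ball a R"])
      qed
      ultimately show "dist (deriv (F n) z) (deriv f z) < e"
        using d \<open>e > 0\<close> by (simp add: dist_norm)
    qed
  qed
qed

text \<open>The maximum principle, applied to \<open>F n - f\<close>.\<close>
lemma uniform_limit_sphere_imp_cball:
  assumes "0 < r" "r < R" "\<forall>\<^sub>F n in sequentially. F n holomorphic_on ball a R" "f holomorphic_on ball a R"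
    and lim: "uniform_limit (sphere a r) F f sequentially"
  shows "uniform_limit (cball a r) F f sequentially"
proof (rule uniform_limitI)
  fix e :: real assume "e > 0"
  then have "\<forall>\<^sub>F n in sequentially. \<forall>z\<in>sphere a r. dist (F n z) (f z) < e / 2"
    using lim by (intro uniform_limitD) auto
  then show "\<forall>\<^sub>F n in sequentially. \<forall>z\<in>cball a r. dist (F n z) (f z) < e"
    using assms(3)
  proof eventually_elim
    case (elim n)
    have holo: "(\<lambda>z. F n z - f z) holomorphic_on cball a r"
      using elim(2) assms by (intro holomorphic_intros) (auto elim!: holomorphic_on_subset)
    have "norm (F n z - f z) \<le> e / 2" if "z \<in> cball a r" for z
    proof (rule maximum_modulus_frontier[of "\<lambda>z. F n z - f z" "cball a r"])
      show "(\<lambda>z. F n z - f z) holomorphic_on interior (cball a r)"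
        using holo by (rule holomorphic_on_subset) (rule interior_subset)
      show "continuous_on (closure (cball a r)) (\<lambda>z. F n z - f z)"
        using holo by (simp add: holomorphic_on_imp_continuous_on)
    qed (use that elim(1) \<open>r > 0\<close> in \<open>auto simp: dist_norm less_imp_le\<close>)
    then show ?case using \<open>e > 0\<close> by (force simp: dist_norm)
  qed
qed

section \<open>A Riccati inequality\<close>

text \<open>
  If \<open>w = 1 / f\<close>, the hypothesis says \<open>|f'| \<ge> L\<close>, and the lemma is a quantitative form of the
  following: walking from \<open>a\<close> so that \<open>|f|\<close> decreases as fast as possible, it decreases at rate at
  least \<open>L\<close>, so that \<open>|f a| < L * \<delta>\<close> forces a zero of \<open>f\<close> in the disc, that is, a pole of \<open>w\<close>.
  Instead of following a curve, one looks at a maximum point \<open>p\<close> of \<open>|w z| * (\<rho> - |z - a|)\<close>. If the maximum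
  exceeds \<open>1 / L\<close>, then a small step from \<open>p\<close> in the direction in which \<open>|w|\<close> grows fastest gains
  more from the first factor than it loses from the second.
\<close>

lemma norm_le_of_Riccati_inequality:
  assumes "\<delta> > 0" "L > 0" and holo: "w holomorphic_on ball a \<delta>"
    and riccati: "\<And>z. z \<in> ball a \<delta> \<Longrightarrow> norm (deriv w z) \<ge> L * (norm (w z))\<^sup>2"
  shows "norm (w a) \<le> 1 / (L * \<delta>)"
proof (rule ccontr)
  assume "\<not> ?thesis"
  then have big: "norm (w a) > 1 / (L * \<delta>)" by simp
  then have wa: "norm (w a) > 0"
    using assms by (smt (verit) divide_pos_pos mult_pos_pos)
  have "1 / (L * norm (w a)) < \<delta>"
    using big wa assms by (simp add: field_simps)
  then obtain \<rho> where \<rho>: "1 / (L * norm (w a)) < \<rho>" "\<rho> < \<delta>" using dense by blast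
  have "\<rho> > 0" using \<rho>(1) wa \<open>L > 0\<close> by (smt (verit) divide_pos_pos mult_pos_pos)
  define \<Phi> where "\<Phi> z = norm (w z) * (\<rho> - dist a z)" for z
  have sub: "cball a \<rho> \<subseteq> ball a \<delta>" using \<rho> by auto
  have "continuous_on (cball a \<rho>) \<Phi>"
    unfolding \<Phi>_def using holo sub
    by (intro continuous_intros holomorphic_on_imp_continuous_on) (auto intro: holomorphic_on_subset)
  then obtain p where p: "p \<in> cball a \<rho>" "\<And>z. z \<in> cball a \<rho> \<Longrightarrow> \<Phi> z \<le> \<Phi> p"
    using continuous_attains_sup[of "cball a \<rho>" \<Phi>] \<open>\<rho> > 0\<close> by auto
  define s where "s = \<rho> - dist a p"
  have "1 / L < \<Phi> a"
    using \<rho>(1) wa \<open>L > 0\<close> by (simp add: \<Phi>_def field_simps)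
  also have "\<Phi> a \<le> \<Phi> p" using p \<open>\<rho> > 0\<close> by auto
  finally have \<Phi>p: "1 / L < norm (w p) * s" by (simp add: \<Phi>_def s_def)
  then have "norm (w p) * s > 0" using \<open>L > 0\<close> by (smt (verit) divide_pos_pos)
  then have s: "s > 0" and wp: "norm (w p) > 0"
    using zero_less_mult_pos[of "norm (w p)" s] by (auto simp: zero_less_mult_iff)
  have pball: "p \<in> ball a \<delta>" using p(1) sub by blast
  have dw: "norm (deriv w p) \<ge> L * (norm (w p))\<^sup>2" using riccati[OF pball] .
  then have dw0: "norm (deriv w p) > 0" using \<open>L > 0\<close> wp by (smt (verit) mult_pos_pos zero_less_power)
  \<comment> \<open>\<open>d\<close> is the direction of steepest ascent of \<open>|w|\<close> at \<open>p\<close>. Along it \<open>|w|\<close> is bounded below by the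
    real differentiable function \<open>\<eta>\<close>, the component of \<open>w\<close> in the direction of \<open>w p\<close>.\<close>
  define \<sigma> where "\<sigma> = sgn (w p)"
  have \<sigma>: "norm \<sigma> = 1" "w p = of_real (norm (w p)) * \<sigma>"
    using wp by (auto simp: \<sigma>_def norm_sgn) (simp add: sgn_eq)
  have sg: "\<sigma> * cnj \<sigma> = 1"
    using complex_norm_square[of \<sigma>] by (simp only: \<sigma>(1) of_real_1 power_one)
  have sg': "w p * cnj \<sigma> = of_real (norm (w p))"
    using arg_cong[OF \<sigma>(2), of "\<lambda>x. x * cnj \<sigma>"] by (simp only: mult.assoc sg mult_1_right)
  define d where "d = of_real (norm (deriv w p)) / deriv w p * \<sigma>"
  have dn: "norm d = 1" using dw0 \<sigma>(1) by (simp add: d_def norm_mult norm_divide)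
  define \<eta> where "\<eta> t = Re (w (p + of_real t * d) * cnj \<sigma>)" for t
  define \<psi> where "\<psi> t = \<eta> t * (s - t)" for t
  have \<eta>0: "\<eta> 0 = norm (w p)" unfolding \<eta>_def by (simp only: of_real_0 mult_zero_left add_0_right sg' Re_complex_of_real)
  have "(w has_field_derivative deriv w p) (at p)"
    using holo pball by (intro holomorphic_derivI[of w "ball a \<delta>"]) auto
  then have 1: "(w has_field_derivative deriv w p) (at (p + of_real 0 * d))" by simp
  have "((\<lambda>t. p + of_real t * d) has_vector_derivative d) (at 0)"
    unfolding has_vector_derivative_def
    by (auto intro!: derivative_eq_intros simp: scaleR_conv_of_real)
  from field_vector_diff_chain_at[OF this 1]
  have ray: "((\<lambda>t. w (p + of_real t * d)) has_vector_derivative (d * deriv w p)) (at 0)"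
    by (simp add: o_def)
  have "bounded_linear (\<lambda>x. Re (x * cnj \<sigma>))"
    by (rule bounded_linear_compose[OF bounded_linear_Re bounded_linear_mult_left])
  from bounded_linear.has_vector_derivative[OF this ray]
  have "(\<eta> has_field_derivative Re (d * deriv w p * cnj \<sigma>)) (at 0)"
    unfolding \<eta>_def has_real_derivative_iff_has_vector_derivative .
  moreover have "d * deriv w p * cnj \<sigma> = of_real (norm (deriv w p))"
    using dw0 sg by (simp add: d_def mult.assoc)
  ultimately have "(\<eta> has_field_derivative norm (deriv w p)) (at 0)"
    by (simp only: Re_complex_of_real)
  then have "(\<psi> has_field_derivative norm (deriv w p) * s - norm (w p)) (at 0)"
    unfolding \<psi>_def by (auto intro!: derivative_eq_intros simp: \<eta>0)
  moreover have "norm (deriv w p) * s - norm (w p) > 0"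
  proof -
    have "norm (w p) * 1 < norm (w p) * (L * (norm (w p) * s))"
      using \<Phi>p wp \<open>L > 0\<close> by (intro mult_strict_left_mono) (auto simp: field_simps)
    also have "\<dots> \<le> norm (deriv w p) * s"
      using mult_right_mono[OF dw, of s] s by (simp add: power2_eq_square mult_ac)
    finally show ?thesis by simp
  qed
  ultimately obtain \<tau> where \<tau>: "\<tau> > 0" "\<And>h. 0 < h \<Longrightarrow> h < \<tau> \<Longrightarrow> \<psi> 0 < \<psi> (0 + h)"
    using DERIV_pos_inc_right by metis
  define t where "t = min \<tau> s / 2"
  have t: "t > 0" "t < \<tau>" "t < s" using \<tau>(1) s by (auto simp: t_def)
  define q where "q = p + of_real t * d"
  have dpq: "dist p q = t" using t dn by (simp add: q_def dist_norm norm_mult)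
  have daq: "dist a q \<le> dist a p + t" using dist_triangle[of a q p] dpq by (simp add: dist_commute)
  then have "q \<in> cball a \<rho>" using t by (simp add: s_def)
  then have "\<Phi> q \<le> \<Phi> p" by (rule p(2))
  also have "\<Phi> p = \<psi> 0" by (simp add: \<Phi>_def \<psi>_def s_def \<eta>0)
  also have "\<psi> 0 < \<psi> t" using \<tau>(2)[of t] t by simp
  also have "\<psi> t \<le> norm (w q) * (s - t)"
  proof -
    have "Re (w q * cnj \<sigma>) \<le> norm (w q * cnj \<sigma>)" by (rule complex_Re_le_cmod)
    also have "\<dots> = norm (w q)" using \<sigma>(1) by (simp add: norm_mult)
    finally show ?thesis unfolding \<psi>_def \<eta>_def q_def using t by (intro mult_right_mono) auto
  qed
  also have "\<dots> \<le> \<Phi> q"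
    unfolding \<Phi>_def using daq by (intro mult_left_mono) (auto simp: s_def)
  finally show False by simp
qed

section \<open>The holomorphic functions attached to a meromorphic function without critical points\<close>

text \<open>
  The value \<open>0\<close> at the poles is the one that makes these functions holomorphic there. They are
  homogeneous coordinates for \<open>f\<close>: away from the poles, \<open>inv_log_deriv f z / inv_deriv f z = f z\<close>.
\<close>

definition inv_deriv :: "(complex \<Rightarrow> complex) \<Rightarrow> complex \<Rightarrow> complex" where
  "inv_deriv f z = (if is_pole f z then 0 else 1 / deriv f z)"

definition inv_log_deriv :: "(complex \<Rightarrow> complex) \<Rightarrow> complex \<Rightarrow> complex" where
  "inv_log_deriv f z = (if is_pole f z then 0 else f z / deriv f z)"

definition recip :: "(complex \<Rightarrow> complex) \<Rightarrow> complex \<Rightarrow> complex" where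
  "recip f z = (if is_pole f z then 0 else 1 / f z)"

locale critical_free =
  fixes f :: "complex \<Rightarrow> complex" and D :: "complex set"
  assumes nice: "f nicely_meromorphic_on D"
    and open_D: "open D"
    and deriv_nz: "\<And>z. z \<in> D \<Longrightarrow> \<not> is_pole f z \<Longrightarrow> deriv f z \<noteq> 0"
begin

lemma regular_point:
  assumes "z \<in> D" "\<not> is_pole f z"
  obtains r where "r > 0" "ball z r \<subseteq> D" "f holomorphic_on ball z r" "\<And>w. w \<in> ball z r \<Longrightarrow> \<not> is_pole f w"
proof -
  have "f analytic_on {z}"
    using nice assms by (rule nicely_meromorphic_on_imp_analytic_at)
  then obtain S where S: "open S" "z \<in> S" "f holomorphic_on S"
    unfolding analytic_at by blast
  obtain r where r: "r > 0" "ball z r \<subseteq> S \<inter> D"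
    using S assms open_D by (meson IntI open_Int openE)
  then have "f holomorphic_on ball z r"
    using S by (auto elim: holomorphic_on_subset)
  with r show ?thesis
    by (intro that[of r] not_is_pole_holomorphic[OF open_ball _ \<open>f holomorphic_on ball z r\<close>]) auto
qed

lemma pole_point:
  assumes "z \<in> D" "is_pole f z"
  obtains r k and m :: nat where "r > 0" "ball z r \<subseteq> D" "m > 0" "k holomorphic_on ball z r"
    "\<And>w. w \<in> ball z r \<Longrightarrow> k w \<noteq> 0"
    "\<And>w. w \<in> ball z r - {z} \<Longrightarrow> \<not> is_pole f w"
    "\<And>w. w \<in> ball z r - {z} \<Longrightarrow> f w = k w / (w - z) ^ m"
proof -
  have "f meromorphic_on {z}"
    using nice assms(1) by (auto simp: nicely_meromorphic_on_def intro: meromorphic_on_subset)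
  then have "isolated_singularity_at f z"
    by (rule meromorphic_on_isolated_singularity)
  then obtain r0 where r0: "r0 > 0" "f analytic_on ball z r0 - {z}"
    by (auto simp: isolated_singularity_at_def)
  obtain r1 where r1: "r1 > 0" "ball z r1 \<subseteq> ball z r0 \<inter> D"
    using r0 assms open_D by (meson IntI open_Int openE open_ball centre_in_ball)
  define k where "k = zor_poly f z"
  define m where "m = nat (- zorder f z)"
  have holo: "f holomorphic_on ball z r1 - {z}"
    using r0(2) r1 by (intro analytic_imp_holomorphic) (auto elim!: analytic_on_subset)
  from zorder_exist_pole[OF holo open_ball _ assms(2)] r1(1)
  obtain r where r: "zorder f z < 0" "k z \<noteq> 0" "r > 0" "cball z r \<subseteq> ball z r1" "k holomorphic_on cball z r"
    "\<forall>w\<in>cball z r - {z}. f w = k w / (w - z) ^ m \<and> k w \<noteq> 0"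
    by (auto simp: k_def m_def)
  show ?thesis
  proof (rule that[of r m k])
    show "\<not> is_pole f w" if "w \<in> ball z r - {z}" for w
      using that subsetD[OF r(4), of w] holo by (intro not_is_pole_holomorphic[of "ball z r1 - {z}"]) auto
    show "k holomorphic_on ball z r" using r(5) by (rule holomorphic_on_subset) auto
    show "k w \<noteq> 0" if "w \<in> ball z r" for w using r(2,6) that by (cases "w = z") auto
    show "ball z r \<subseteq> D" using r(4) r1(2) ball_subset_cball[of z r] by blast
  qed (use r in \<open>auto simp: m_def\<close>)
qed

lemma deriv_at_pole:
  assumes "k holomorphic_on ball z r" "w \<in> ball z r - {z}" "m > 0"
    and eq: "\<And>w. w \<in> ball z r - {z} \<Longrightarrow> f w = k w / (w - z) ^ m"
  shows "deriv f w = (deriv k w * (w - z) - of_nat m * k w) / (w - z) ^ Suc m"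
proof (rule DERIV_imp_deriv, rule has_field_derivative_transform_within_open)
  have "(k has_field_derivative deriv k w) (at w)"
    using assms by (intro holomorphic_derivI[of k "ball z r"]) auto
  then have "((\<lambda>w. k w / (w - z) ^ m) has_field_derivative
     (deriv k w * (w - z) ^ m - k w * (of_nat m * (w - z) ^ (m - 1))) / ((w - z) ^ m * (w - z) ^ m)) (at w)"
    using assms by (auto intro!: derivative_eq_intros)
  moreover have "(deriv k w * (w - z) ^ m - k w * (of_nat m * (w - z) ^ (m - 1))) / ((w - z) ^ m * (w - z) ^ m)
      = (deriv k w * (w - z) - of_nat m * k w) / (w - z) ^ Suc m"
  proof -
    obtain j where j: "m = Suc j" using assms(3) by (cases m) auto
    define t where "t = w - z"
    have "t \<noteq> 0" using assms(2) by (simp add: t_def)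
    then show ?thesis
      unfolding t_def[symmetric] j by (simp add: divide_simps) (simp add: algebra_simps)
  qed
  ultimately show "((\<lambda>w. k w / (w - z) ^ m) has_field_derivative
      (deriv k w * (w - z) - of_nat m * k w) / (w - z) ^ Suc m) (at w)"
    by simp
  show "k w / (w - z) ^ m = f w" if "w \<in> ball z r - {z}" for w using eq that by simp
qed (use assms in auto)

text \<open>
  At a pole \<open>z\<close> write \<open>f w = k w / (w - z) ^ m\<close>. Then \<open>deriv f w = h w / (w - z) ^ Suc m\<close> with
  \<open>h z = - m * k z \<noteq> 0\<close>, so that the two functions are \<open>(w - z) ^ Suc m / h w\<close> and
  \<open>(w - z) * k w / h w\<close>.
\<close>
lemma inv_deriv_analytic: "inv_deriv f analytic_on D"
  and inv_log_deriv_analytic: "inv_log_deriv f analytic_on D"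
proof -
  have "\<exists>r>0. inv_deriv f holomorphic_on ball z r \<and> inv_log_deriv f holomorphic_on ball z r" if z: "z \<in> D" for z
  proof (cases "is_pole f z")
    case False
    obtain r where r: "r > 0" "ball z r \<subseteq> D" "f holomorphic_on ball z r" "\<And>w. w \<in> ball z r \<Longrightarrow> \<not> is_pole f w"
      using regular_point[OF z False] by metis
    have nz: "\<And>w. w \<in> ball z r \<Longrightarrow> deriv f w \<noteq> 0" using deriv_nz r by blast
    have "(\<lambda>w. 1 / deriv f w) holomorphic_on ball z r"
      using r(3) nz by (auto intro!: holomorphic_intros)
    then have u: "inv_deriv f holomorphic_on ball z r"
      by (rule holomorphic_transform) (use r(4) in \<open>auto simp: inv_deriv_def\<close>)
    have "(\<lambda>w. f w / deriv f w) holomorphic_on ball z r"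
      using r(3) nz by (auto intro!: holomorphic_intros)
    then have "inv_log_deriv f holomorphic_on ball z r"
      by (rule holomorphic_transform) (use r(4) in \<open>auto simp: inv_log_deriv_def\<close>)
    with u r(1) show ?thesis by blast
  next
    case True
    obtain r k and m :: nat where r: "r > 0" "ball z r \<subseteq> D" "m > 0" "k holomorphic_on ball z r"
      "\<And>w. w \<in> ball z r \<Longrightarrow> k w \<noteq> 0"
      "\<And>w. w \<in> ball z r - {z} \<Longrightarrow> \<not> is_pole f w"
      "\<And>w. w \<in> ball z r - {z} \<Longrightarrow> f w = k w / (w - z) ^ m"
      using pole_point[OF z True] by metis
    define h where "h w = deriv k w * (w - z) - of_nat m * k w" for w
    have df: "deriv f w = h w / (w - z) ^ Suc m" if "w \<in> ball z r - {z}" for w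
      unfolding h_def by (rule deriv_at_pole[OF r(4) that r(3) r(7)])
    have h: "h w \<noteq> 0" if "w \<in> ball z r" for w
    proof (cases "w = z")
      case True
      then show ?thesis using r(3) r(5)[OF that] by (simp add: h_def)
    next
      case False
      then have "deriv f w \<noteq> 0" using that r by (intro deriv_nz) auto
      then show ?thesis using df[of w] False that by auto
    qed
    have "(\<lambda>w. (w - z) ^ Suc m / h w) holomorphic_on ball z r"
      using h r(4) unfolding h_def by (intro holomorphic_intros) auto
    moreover have "(w - z) ^ Suc m / h w = inv_deriv f w" if "w \<in> ball z r" for w
      using that True r(6) df by (cases "w = z") (auto simp: inv_deriv_def)
    ultimately have u: "inv_deriv f holomorphic_on ball z r"
      by (rule holomorphic_transform)
    have "(\<lambda>w. (w - z) * k w / h w) holomorphic_on ball z r"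
      using h r(4) unfolding h_def by (intro holomorphic_intros) auto
    moreover have "(w - z) * k w / h w = inv_log_deriv f w" if "w \<in> ball z r" for w
      using that True r(6) df r(7) h[OF that] by (cases "w = z") (auto simp: inv_log_deriv_def)
    ultimately have "inv_log_deriv f holomorphic_on ball z r"
      by (rule holomorphic_transform)
    with u r(1) show ?thesis by blast
  qed
  then show "inv_deriv f analytic_on D" "inv_log_deriv f analytic_on D"
    unfolding analytic_on_def by blast+
qed

lemma inv_deriv_holomorphic: "inv_deriv f holomorphic_on D"
  and inv_log_deriv_holomorphic: "inv_log_deriv f holomorphic_on D"
  by (auto intro: analytic_imp_holomorphic inv_deriv_analytic inv_log_deriv_analytic)

lemma to_sphere_eq_ratio:
  assumes "z \<in> D"
  shows "to_sphere f z = ratio (inv_log_deriv f z) (inv_deriv f z)"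
  using deriv_nz[OF assms] by (auto simp: to_sphere_def ratio_def inv_log_deriv_def inv_deriv_def)

text \<open>
  With \<open>u = inv_deriv f\<close> and \<open>v = inv_log_deriv f\<close> this is the identity \<open>(v / u)' = f' = 1 / u\<close> with
  denominators cleared. In this form it also holds at the poles, and it passes to limits of \<open>u\<close> and \<open>v\<close>.
\<close>
lemma wronskian:
  assumes z: "z \<in> D"
  shows "deriv (inv_log_deriv f) z * inv_deriv f z - inv_log_deriv f z * deriv (inv_deriv f) z = inv_deriv f z"
proof (cases "is_pole f z")
  case False
  obtain r where r: "r > 0" "ball z r \<subseteq> D" "f holomorphic_on ball z r" "\<And>w. w \<in> ball z r \<Longrightarrow> \<not> is_pole f w"
    using regular_point[OF z False] by metis
  have nz: "deriv f z \<noteq> 0" using deriv_nz z False by blast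
  have d1: "(f has_field_derivative deriv f z) (at z)"
    using r by (intro holomorphic_derivI[of f "ball z r"]) auto
  have d2: "(deriv f has_field_derivative deriv (deriv f) z) (at z)"
    using r by (intro holomorphic_derivI[of _ "ball z r"] holomorphic_intros) auto
  have "((\<lambda>w. 1 / deriv f w) has_field_derivative (- deriv (deriv f) z / (deriv f z)\<^sup>2)) (at z)"
    using d2 nz by (auto intro!: derivative_eq_intros simp: power2_eq_square)
  then have "(inv_deriv f has_field_derivative (- deriv (deriv f) z / (deriv f z)\<^sup>2)) (at z)"
    by (rule has_field_derivative_transform_within_open[of _ _ _ "ball z r"]) (use r in \<open>auto simp: inv_deriv_def\<close>)
  moreover have "((\<lambda>w. f w / deriv f w) has_field_derivative (1 - f z * deriv (deriv f) z / (deriv f z)\<^sup>2)) (at z)"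
    using d1 d2 nz by (auto intro!: derivative_eq_intros simp: power2_eq_square field_simps)
  then have "(inv_log_deriv f has_field_derivative (1 - f z * deriv (deriv f) z / (deriv f z)\<^sup>2)) (at z)"
    by (rule has_field_derivative_transform_within_open[of _ _ _ "ball z r"]) (use r in \<open>auto simp: inv_log_deriv_def\<close>)
  ultimately have eqs: "deriv (inv_deriv f) z = - deriv (deriv f) z / (deriv f z)\<^sup>2"
      "deriv (inv_log_deriv f) z = 1 - f z * deriv (deriv f) z / (deriv f z)\<^sup>2"
    using DERIV_imp_deriv by blast+
  show ?thesis
    unfolding eqs using nz False by (simp add: inv_deriv_def inv_log_deriv_def field_simps power2_eq_square)
qed (simp add: inv_deriv_def inv_log_deriv_def)

text \<open>
  This is how zeros of \<open>f\<close> are excluded near a point: it suffices that \<open>deriv (inv_log_deriv f)\<close> stays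
  away from \<open>1\<close> there, a condition that is stable under locally uniform convergence.
\<close>
lemma deriv_inv_log_deriv_at_zero:
  assumes "z \<in> D" "\<not> is_pole f z" "f z = 0"
  shows "deriv (inv_log_deriv f) z = 1"
  using wronskian[OF assms(1)] deriv_nz[OF assms(1,2)] assms by (simp add: inv_deriv_def inv_log_deriv_def)

text \<open>At a pole both sides are \<open>0\<close>, because \<open>0 / 0 = 0\<close>.\<close>
lemma recip_eq_divide:
  assumes "z \<in> D"
  shows "recip f z = inv_deriv f z / inv_log_deriv f z"
  using deriv_nz[of z] assms by (auto simp: recip_def inv_log_deriv_def inv_deriv_def)

context
  fixes S :: "complex set"
  assumes open_S: "open S" and S_D: "S \<subseteq> D"
    and zero_free: "\<And>z. z \<in> S \<Longrightarrow> \<not> is_pole f z \<Longrightarrow> f z \<noteq> 0"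
begin

lemma recip_holomorphic: "recip f holomorphic_on S"
proof -
  have "\<exists>r>0. recip f holomorphic_on ball z r" if z: "z \<in> S" and zD: "z \<in> D" for z
  proof (cases "is_pole f z")
    case False
    obtain r where r: "r > 0" "ball z r \<subseteq> D" "f holomorphic_on ball z r" "\<And>w. w \<in> ball z r \<Longrightarrow> \<not> is_pole f w"
      using regular_point[OF zD False] by metis
    obtain r' where r': "r' > 0" "ball z r' \<subseteq> S \<inter> ball z r"
      using open_S z r(1) by (meson IntI open_Int openE open_ball centre_in_ball)
    have "\<And>w. w \<in> ball z r' \<Longrightarrow> f w \<noteq> 0"
      using r(4) r'(2) zero_free by blast
    then have "(\<lambda>w. 1 / f w) holomorphic_on ball z r'"
      using r(3) r'(2) by (intro holomorphic_intros) (auto elim!: holomorphic_on_subset)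
    then have "recip f holomorphic_on ball z r'"
      by (rule holomorphic_transform) (use r(4) r'(2) in \<open>auto simp: recip_def\<close>)
    with r'(1) show ?thesis by blast
  next
    case True
    obtain r k and m :: nat where r: "r > 0" "ball z r \<subseteq> D" "m > 0" "k holomorphic_on ball z r"
      "\<And>w. w \<in> ball z r \<Longrightarrow> k w \<noteq> 0"
      "\<And>w. w \<in> ball z r - {z} \<Longrightarrow> \<not> is_pole f w"
      "\<And>w. w \<in> ball z r - {z} \<Longrightarrow> f w = k w / (w - z) ^ m"
      using pole_point[OF zD True] by metis
    have "(\<lambda>w. (w - z) ^ m / k w) holomorphic_on ball z r"
      using r(4,5) by (intro holomorphic_intros) auto
    moreover have "(w - z) ^ m / k w = recip f w" if "w \<in> ball z r" for w
      using that True r(3,6,7) by (cases "w = z") (auto simp: recip_def)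
    ultimately have "recip f holomorphic_on ball z r"
      by (rule holomorphic_transform)
    with r(1) show ?thesis by blast
  qed
  then have "recip f analytic_on S" using S_D unfolding analytic_on_def by blast
  then show ?thesis by (rule analytic_imp_holomorphic)
qed

text \<open>
  The relation \<open>(1 / f)' = - f' / f\<^sup>2\<close>, written so that it is also true at the poles. A small bound on
  \<open>inv_deriv f\<close> turns it into a Riccati inequality for \<open>1 / f\<close>.
\<close>
lemma deriv_recip:
  assumes z: "z \<in> S"
  shows "deriv (recip f) z * inv_deriv f z = - (recip f z)\<^sup>2"
proof (cases "is_pole f z")
  case False
  obtain r where r: "r > 0" "ball z r \<subseteq> D" "f holomorphic_on ball z r" "\<And>w. w \<in> ball z r \<Longrightarrow> \<not> is_pole f w"
    using regular_point[OF subsetD[OF S_D z] False] by metis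
  have nz: "deriv f z \<noteq> 0" "f z \<noteq> 0" using deriv_nz z S_D zero_free False by blast+
  have "(f has_field_derivative deriv f z) (at z)"
    using r by (intro holomorphic_derivI[of f "ball z r"]) auto
  then have "((\<lambda>w. 1 / f w) has_field_derivative (- deriv f z / (f z)\<^sup>2)) (at z)"
    using nz by (auto intro!: derivative_eq_intros simp: power2_eq_square)
  then have "(recip f has_field_derivative (- deriv f z / (f z)\<^sup>2)) (at z)"
    by (rule has_field_derivative_transform_within_open[of _ _ _ "ball z r"]) (use r in \<open>auto simp: recip_def\<close>)
  then have "deriv (recip f) z = - deriv f z / (f z)\<^sup>2" by (rule DERIV_imp_deriv)
  then show ?thesis
    using nz False by (simp add: recip_def inv_deriv_def field_simps power2_eq_square)
qed (simp add: recip_def inv_deriv_def)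

end

end

lemma open_nonzero_set:
  assumes "f holomorphic_on S" "open S"
  shows "open {z \<in> S. f z \<noteq> 0}"
proof -
  have "open (S \<inter> f -` (- {0}))"
    using assms by (intro continuous_open_preimage holomorphic_on_imp_continuous_on) auto
  moreover have "S \<inter> f -` (- {0}) = {z \<in> S. f z \<noteq> 0}" by auto
  ultimately show ?thesis by simp
qed

section \<open>Limits of the coordinates at a zero of the denominator\<close>

text \<open>
  Let \<open>u\<close> vanish at \<open>a\<close> to the exact order \<open>k\<close>. Comparing the lowest terms in \<open>(v' - 1) * u = v * u'\<close>
  shows first that \<open>v a = 0\<close> and then that \<open>v' a - 1 = k * v' a\<close>. Hence \<open>v' a\<close> is neither \<open>0\<close> nor \<open>1\<close>, and \<open>k \<noteq> 1\<close>.
  So \<open>a\<close> is a simple zero of \<open>v\<close> and at least a double zero of \<open>u\<close>, and \<open>u / v\<close> extends to a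
  holomorphic function vanishing at \<open>a\<close>.
\<close>

lemma wronskian_solution_at_zero:
  assumes holo: "u holomorphic_on S" "v holomorphic_on S" and S: "open S" "connected S" "a \<in> S"
    and ua: "u a = 0" and nz: "\<exists>z\<in>S. u z \<noteq> 0"
    and wron: "\<And>z. z \<in> S \<Longrightarrow> deriv v z * u z - v z * deriv u z = u z"
  obtains r W where "r > 0" "ball a r \<subseteq> S" "W holomorphic_on ball a r" "deriv v a \<noteq> 1"
    "W a = 0" "\<And>z. z \<in> ball a r - {a} \<Longrightarrow> v z \<noteq> 0 \<and> W z = u z / v z \<and> u z \<noteq> 0"
proof -
  have "\<not> u constant_on S" using nz ua S(3) unfolding constant_on_def by metis
  from holomorphic_factor_zero_nonconstant[OF holo(1) S ua this]
  obtain p r0 k where k: "(0::nat) < k" and r0: "r0 > 0" "ball a r0 \<subseteq> S" and p: "p holomorphic_on ball a r0"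
    "\<And>z. z \<in> ball a r0 \<Longrightarrow> u z = (z - a) ^ k * p z" "\<And>z. z \<in> ball a r0 \<Longrightarrow> p z \<noteq> 0"
    by metis
  \<comment> \<open>\<open>deriv u z = (z - a) ^ (k - 1) * h z\<close>\<close>
  define h where "h z = of_nat k * p z + (z - a) * deriv p z" for z
  have h_holo: "h holomorphic_on ball a r0"
    unfolding h_def using p(1) by (intro holomorphic_intros) auto
  have ha: "h a \<noteq> 0" using k p(3) r0 by (simp add: h_def)
  have key: "(deriv v z - 1) * (z - a) * p z = v z * h z" if z: "z \<in> ball a r0 - {a}" for z
  proof -
    have "(p has_field_derivative deriv p z) (at z)"
      using p(1) z by (intro holomorphic_derivI[of p "ball a r0"]) auto
    then have "((\<lambda>z. (z - a) ^ k * p z) has_field_derivative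
        (of_nat k * (z - a) ^ (k - 1) * p z + (z - a) ^ k * deriv p z)) (at z)"
      by (auto intro!: derivative_eq_intros)
    then have "(u has_field_derivative
        (of_nat k * (z - a) ^ (k - 1) * p z + (z - a) ^ k * deriv p z)) (at z)"
      by (rule has_field_derivative_transform_within_open[of _ _ _ "ball a r0"]) (use z p(2) in auto)
    moreover have pow: "(z - a) ^ k = (z - a) ^ (k - 1) * (z - a)"
      using k by (cases k) auto
    ultimately have du: "deriv u z = (z - a) ^ (k - 1) * h z"
      by (simp add: DERIV_imp_deriv h_def algebra_simps)
    have "(z - a) ^ (k - 1) * ((deriv v z - 1) * (z - a) * p z) = (deriv v z - 1) * u z"
      using p(2) z by (simp add: pow)
    also have "\<dots> = v z * deriv u z"
      using wron[of z] z r0 by (auto simp: algebra_simps)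
    also have "\<dots> = (z - a) ^ (k - 1) * (v z * h z)" by (simp add: du)
    finally show ?thesis using z by simp
  qed
  have dv: "deriv v holomorphic_on ball a r0" 
    using holo(2) r0(2) S(1) by (meson holomorphic_deriv holomorphic_on_subset)
  have v_ball: "v holomorphic_on ball a r0" using holo(2) r0(2) by (rule holomorphic_on_subset)
  obtain r1 where r1: "r1 > 0" "ball a r1 \<subseteq> ball a r0" "\<And>z. z \<in> ball a r1 \<Longrightarrow> h z \<noteq> 0"
  proof -
    have "open {z \<in> ball a r0. h z \<noteq> 0}"
      using h_holo by (rule open_nonzero_set) simp
    then obtain e where "e > 0" "ball a e \<subseteq> {z \<in> ball a r0. h z \<noteq> 0}"
      using ha r0 by (metis (mono_tags, lifting) centre_in_ball mem_Collect_eq openE)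
    then show ?thesis by (intro that[of e]) auto
  qed
  define q where "q z = (deriv v z - 1) * p z / h z" for z
  have q_holo: "q holomorphic_on ball a r1"
    unfolding q_def using r1(3)
    by (intro holomorphic_on_divide holomorphic_on_mult holomorphic_on_diff holomorphic_on_const
        holomorphic_on_subset[OF dv r1(2)] holomorphic_on_subset[OF p(1) r1(2)]
        holomorphic_on_subset[OF h_holo r1(2)])
  have vq': "v z = (z - a) * q z" if "z \<in> ball a r1 - {a}" for z
    using key[of z] that r1 by (auto simp: q_def field_simps)
  have "v a = 0"
  proof -
    have "v \<midarrow>a\<rightarrow> v a"
      using v_ball r0 by (metis centre_in_ball continuous_on_interior holomorphic_on_imp_continuous_on interior_open isContD open_ball)
    moreover have "(\<lambda>z. (z - a) * q z) \<midarrow>a\<rightarrow> (a - a) * q a"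
      using q_holo r1 by (intro tendsto_intros) 
        (metis centre_in_ball continuous_on_interior holomorphic_on_imp_continuous_on interior_open isContD open_ball)
    moreover have "\<forall>\<^sub>F z in at a. z \<in> ball a r1 - {a}"
      using r1(1) by (intro eventually_at_in_open) auto
    then have "\<forall>\<^sub>F z in at a. v z = (z - a) * q z"
      by eventually_elim (rule vq')
    ultimately have "v \<midarrow>a\<rightarrow> v a" "v \<midarrow>a\<rightarrow> (a - a) * q a"
      by (simp_all add: tendsto_cong)
    then have "v a = (a - a) * q a" by (rule LIM_unique)
    then show ?thesis by simp
  qed
  then have vq: "v z = (z - a) * q z" if "z \<in> ball a r1" for z
    using vq'[of z] that by (cases "z = a") auto
  have dvq: "deriv v a = q a"
  proof (rule DERIV_imp_deriv, rule has_field_derivative_transform_within_open[of _ _ _ "ball a r1"])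
    have "(q has_field_derivative deriv q a) (at a)"
      using q_holo r1 by (intro holomorphic_derivI[of q "ball a r1"]) auto
    then show "((\<lambda>z. (z - a) * q z) has_field_derivative q a) (at a)"
      by (auto intro!: derivative_eq_intros)
  qed (use r1 vq in auto)
  moreover have "q a = (deriv v a - 1) / of_nat k"
    using p(3)[of a] r0(1) by (simp add: q_def h_def)
  ultimately have eq: "of_nat k * deriv v a = deriv v a - 1"
    using k by (simp add: field_simps)
  then have dv1: "deriv v a \<noteq> 1" using k by auto
  have "deriv v a \<noteq> 0" using eq by auto
  have k2: "k \<ge> 2"
  proof (rule ccontr)
    assume "\<not> k \<ge> 2" with k have "k = 1" by simp
    with eq show False by simp
  qed
  have "q a \<noteq> 0" using dvq \<open>deriv v a \<noteq> 0\<close> by simp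
  obtain r where r: "r > 0" "ball a r \<subseteq> ball a r1" "\<And>z. z \<in> ball a r \<Longrightarrow> q z \<noteq> 0"
  proof -
    have "open {z \<in> ball a r1. q z \<noteq> 0}"
      using q_holo by (rule open_nonzero_set) simp
    then obtain e where "e > 0" "ball a e \<subseteq> {z \<in> ball a r1. q z \<noteq> 0}"
      using \<open>q a \<noteq> 0\<close> r1 by (metis (mono_tags, lifting) centre_in_ball mem_Collect_eq openE)
    then show ?thesis by (intro that[of e]) auto
  qed
  define W where "W z = (z - a) ^ (k - 1) * p z / q z" for z
  show ?thesis
  proof (rule that[of r W])
    show "W holomorphic_on ball a r"
      unfolding W_def using p(1) q_holo r r1(2) by (intro holomorphic_intros) (auto elim!: holomorphic_on_subset)
    show "v z \<noteq> 0 \<and> W z = u z / v z \<and> u z \<noteq> 0" if "z \<in> ball a r - {a}" for z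
    proof -
      have z: "z \<in> ball a r1" "z \<in> ball a r0" "q z \<noteq> 0" "z \<noteq> a"
        using that subsetD[OF r(2), of z] subsetD[OF r1(2), of z] r(3)[of z] by auto
      have "(z - a) ^ k = (z - a) * (z - a) ^ (k - 1)" using k by (cases k) auto
      then show ?thesis using z p vq[OF z(1)] by (simp add: W_def)
    qed
    show "W a = 0" using k2 by (simp add: W_def)
  qed (use r r1 r0 dv1 in auto)
qed

section \<open>Bounds for the coordinates of a member of the family\<close>

text \<open>
  Since \<open>1 + x \<le> 2 * (1 + x powr \<alpha>)\<close> for \<open>\<alpha> \<ge> 1\<close>, the differential inequality bounds both \<open>1 / f'\<close> and
  \<open>f / f'\<close>. The last estimate is \<open>C * |f| powr \<alpha> \<le> |f'|\<close> divided by \<open>|f'| powr \<alpha>\<close>. It says something about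
  points where \<open>1 / f'\<close> is small only if \<open>\<alpha> > 1\<close>, and this is what separates the two cases of the theorem.
\<close>

lemma deriv_family_bounds:
  assumes "f \<in> deriv_family \<alpha> C D" "open D" "C > 0" "\<alpha> \<ge> 1"
  shows deriv_family_critical_free: "critical_free f D"
    and inv_deriv_bound: "z \<in> D \<Longrightarrow> norm (inv_deriv f z) \<le> 2 / C"
    and inv_log_deriv_bound: "z \<in> D \<Longrightarrow> norm (inv_log_deriv f z) \<le> 2 / C"
    and inv_log_deriv_le_inv_deriv:
      "z \<in> D \<Longrightarrow> norm (inv_log_deriv f z) powr \<alpha> \<le> norm (inv_deriv f z) powr (\<alpha> - 1) / C"
proof -
  have nice: "f nicely_meromorphic_on D"
    using assms(1) by (auto simp: deriv_family_def)
  have ineq: "norm (deriv f z) > C * (1 + norm (f z) powr \<alpha>)" if "z \<in> D" "\<not> is_pole f z" for z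
  proof -
    have "deriv_quotient \<alpha> f z > C"
      using assms(1) that by (auto simp: deriv_family_def ext_deriv_quotient_def)
    moreover have "1 + norm (f z) powr \<alpha> > 0" by (simp add: add_pos_nonneg)
    ultimately show ?thesis
      using assms(4) by (simp add: deriv_quotient_def field_simps)
  qed
  have lin: "(1 + x) / 2 \<le> 1 + x powr \<alpha>" if "x \<ge> 0" for x :: real
  proof (cases "x \<ge> 1")
    case True
    then have "x powr 1 \<le> x powr \<alpha>" using assms(4) by (intro powr_mono) auto
    with True show ?thesis by simp
  next
    case False
    then have "(1 + x) / 2 \<le> 1" by simp
    also have "1 \<le> 1 + x powr \<alpha>" by simp
    finally show ?thesis .
  qed
  have ineq': "norm (deriv f z) > C / 2 * (1 + norm (f z))" if "z \<in> D" "\<not> is_pole f z" for z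
  proof -
    have "C * ((1 + norm (f z)) / 2) \<le> C * (1 + norm (f z) powr \<alpha>)"
      using assms(3) by (intro mult_left_mono lin) auto
    with ineq[OF that] show ?thesis by simp
  qed
  have pos: "norm (deriv f z) > 0" if "z \<in> D" "\<not> is_pole f z" for z
  proof -
    have "C / 2 * (1 + norm (f z)) \<ge> 0" using assms(3) by simp
    with ineq'[OF that] show ?thesis by linarith
  qed
  then show "critical_free f D"
    using nice assms(2) by unfold_locales auto
  assume z: "z \<in> D"
  show "norm (inv_deriv f z) \<le> 2 / C"
  proof (cases "is_pole f z")
    case False
    have "C / 2 * 1 \<le> C / 2 * (1 + norm (f z))" using assms(3) by (intro mult_left_mono) auto
    with ineq'[OF z False] have "C / 2 \<le> norm (deriv f z)" by linarith
    then show ?thesis using assms(3) pos[OF z False] False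
      by (simp add: inv_deriv_def norm_divide field_simps)
  qed (use assms(3) in \<open>simp add: inv_deriv_def\<close>)
  show "norm (inv_log_deriv f z) \<le> 2 / C"
  proof (cases "is_pole f z")
    case False
    have "C / 2 * norm (f z) \<le> C / 2 * (1 + norm (f z))" using assms(3) by (intro mult_left_mono) auto
    with ineq'[OF z False] have "C / 2 * norm (f z) \<le> norm (deriv f z)" by linarith
    then show ?thesis using assms(3) pos[OF z False] False
      by (simp add: inv_log_deriv_def norm_divide field_simps)
  qed (use assms(3) in \<open>simp add: inv_log_deriv_def\<close>)
  show "norm (inv_log_deriv f z) powr \<alpha> \<le> norm (inv_deriv f z) powr (\<alpha> - 1) / C"
  proof (cases "is_pole f z")
    case False
    define x where "x = norm (f z)"
    define y where "y = norm (deriv f z)"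
    have xy: "x \<ge> 0" "y > 0" using pos[OF z False] by (auto simp: x_def y_def)
    have "C * x powr \<alpha> \<le> C * (1 + x powr \<alpha>)" using assms(3) by (intro mult_left_mono) auto
    then have "C * x powr \<alpha> \<le> y" using ineq[OF z False] by (simp add: x_def y_def)
    then have "x powr \<alpha> / y powr \<alpha> \<le> (y / C) / y powr \<alpha>"
      using assms(3) by (intro divide_right_mono) (auto simp: field_simps)
    also have "\<dots> = (1 / y) powr (\<alpha> - 1) / C"
      using xy by (simp add: powr_divide powr_diff field_simps)
    finally show ?thesis
      using xy False by (simp add: inv_log_deriv_def inv_deriv_def norm_divide powr_divide x_def y_def)
  qed (use assms in \<open>simp add: inv_deriv_def inv_log_deriv_def\<close>)
qed

section \<open>Sequences with convergent coordinates\<close>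

text \<open>
  The candidate for the chordal limit of \<open>s\<close> is \<open>ratio (v z) (u z)\<close>. Convergence to it near a point is
  shown in three situations: the coordinates \<open>u\<close> and \<open>v\<close> have no common zero there; \<open>u\<close> has an
  isolated zero there; both vanish identically. The only remaining possibility, where convergence can
  indeed fail, is an isolated zero of \<open>v\<close> when \<open>u\<close> vanishes identically.
\<close>

locale convergent_pair =
  fixes D :: "complex set" and s :: "nat \<Rightarrow> complex \<Rightarrow> complex" and u v :: "complex \<Rightarrow> complex"
  assumes open_D: "open D" and connected_D: "connected D"
    and critical_free: "\<And>n. critical_free (s n) D"
    and u_holo: "u holomorphic_on D" and v_holo: "v holomorphic_on D"
    and u_lim: "\<And>K. compact K \<Longrightarrow> K \<subseteq> D \<Longrightarrow> uniform_limit K (\<lambda>n. inv_deriv (s n)) u sequentially"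
    and v_lim: "\<And>K. compact K \<Longrightarrow> K \<subseteq> D \<Longrightarrow> uniform_limit K (\<lambda>n. inv_log_deriv (s n)) v sequentially"
begin

definition chordal_limit_near :: "complex \<Rightarrow> bool" where
  "chordal_limit_near a \<longleftrightarrow> (\<exists>r>0. uniform_limit (cball a r)
     (\<lambda>n z. chordal (to_sphere (s n) z) (ratio (v z) (u z))) (\<lambda>_. 0) sequentially)"

lemma small_cball:
  assumes "open S" "a \<in> S"
  obtains r where "r > 0" "cball a r \<subseteq> S"
  using assms open_contains_cball by blast

lemma wronskian_limit:
  assumes a: "a \<in> D"
  shows "deriv v a * u a - v a * deriv u a = u a"
proof -
  obtain r where r: "r > 0" "cball a r \<subseteq> D" using small_cball[OF open_D a] .
  have lims: "uniform_limit (ball a r) (\<lambda>n. inv_deriv (s n)) u sequentially"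
       "uniform_limit (ball a r) (\<lambda>n. inv_log_deriv (s n)) v sequentially"
    using u_lim[OF compact_cball r(2)] v_lim[OF compact_cball r(2)] ball_subset_cball
    by (auto intro: uniform_limit_on_subset)
  have sub: "ball a r \<subseteq> D" using r(2) ball_subset_cball by blast
  have holo: "inv_deriv (s n) holomorphic_on ball a r" "inv_log_deriv (s n) holomorphic_on ball a r" for n
    using critical_free.inv_deriv_holomorphic[OF critical_free] critical_free.inv_log_deriv_holomorphic[OF critical_free]
      sub by (auto intro: holomorphic_on_subset)
  have "(\<lambda>n. deriv (inv_log_deriv (s n)) a * inv_deriv (s n) a - inv_log_deriv (s n) a * deriv (inv_deriv (s n)) a)
     \<longlonglongrightarrow> deriv v a * u a - v a * deriv u a"
    using r(1) holo
    by (intro tendsto_intros tendsto_uniform_limitI[OF lims(1)] tendsto_uniform_limitI[OF lims(2)]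
        deriv_complex_uniform_limit[OF lims(1)] deriv_complex_uniform_limit[OF lims(2)]) auto
  then have "(\<lambda>n. inv_deriv (s n) a) \<longlonglongrightarrow> deriv v a * u a - v a * deriv u a"
    by (simp add: critical_free.wronskian[OF critical_free a])
  moreover have "(\<lambda>n. inv_deriv (s n) a) \<longlonglongrightarrow> u a"
    using r(1) by (intro tendsto_uniform_limitI[OF lims(1)]) auto
  ultimately show ?thesis by (rule LIMSEQ_unique)
qed

text \<open>
  By uniform convergence of the derivatives, \<open>deriv (inv_log_deriv (s n))\<close> avoids the value \<open>1\<close>, which it
  takes at every zero of \<open>s n\<close>.
\<close>
lemma eventually_zero_free:
  assumes a: "a \<in> D" and d: "deriv v a \<noteq> 1"
  obtains r where "r > 0" "cball a r \<subseteq> D"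
    "\<forall>\<^sub>F n in sequentially. \<forall>z\<in>cball a r. \<not> is_pole (s n) z \<longrightarrow> s n z \<noteq> 0"
proof -
  obtain R where R: "R > 0" "cball a R \<subseteq> D" using small_cball[OF open_D a] .
  have sub: "ball a R \<subseteq> D" using R(2) ball_subset_cball by blast
  define e where "e = norm (deriv v a - 1) / 2"
  have e: "e > 0" using d by (simp add: e_def)
  have "deriv v holomorphic_on D" using v_holo open_D by (rule holomorphic_deriv)
  then have "continuous_on D (deriv v)" by (rule holomorphic_on_imp_continuous_on)
  then have "isCont (deriv v) a"
    using a open_D by (simp add: continuous_on_eq_continuous_at)
  then obtain \<delta> where \<delta>: "\<delta> > 0" "\<And>z. dist z a < \<delta> \<Longrightarrow> dist (deriv v z) (deriv v a) < e"
    using e unfolding continuous_at_eps_delta by blast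
  define r where "r = min R \<delta> / 2"
  have r: "r > 0" "r < R" "r < \<delta>" using R \<delta> by (auto simp: r_def)
  have "uniform_limit (cball a r) (\<lambda>n. deriv (inv_log_deriv (s n))) (deriv v) sequentially"
  proof (rule uniform_limit_deriv_cball)
    show "uniform_limit (ball a R) (\<lambda>n. inv_log_deriv (s n)) v sequentially"
      using v_lim[OF compact_cball R(2)] ball_subset_cball by (rule uniform_limit_on_subset)
    show "inv_log_deriv (s n) holomorphic_on ball a R" for n
      using critical_free.inv_log_deriv_holomorphic[OF critical_free] sub by (rule holomorphic_on_subset)
    show "v holomorphic_on ball a R" using v_holo sub by (rule holomorphic_on_subset)
  qed (use r in auto)
  then have "\<forall>\<^sub>F n in sequentially. \<forall>z\<in>cball a r. dist (deriv (inv_log_deriv (s n)) z) (deriv v z) < e"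
    using e by (rule uniform_limitD)
  then have "\<forall>\<^sub>F n in sequentially. \<forall>z\<in>cball a r. \<not> is_pole (s n) z \<longrightarrow> s n z \<noteq> 0"
  proof eventually_elim
    case (elim n)
    show ?case
    proof (intro ballI impI notI)
      fix z assume z: "z \<in> cball a r" "\<not> is_pole (s n) z" "s n z = 0"
      have "z \<in> D" using z(1) R(2) r by auto
      then have "deriv (inv_log_deriv (s n)) z = 1"
        using critical_free.deriv_inv_log_deriv_at_zero[OF critical_free] z by blast
      then have "dist 1 (deriv v z) < e" using elim z(1) by metis
      moreover have "dist (deriv v z) (deriv v a) < e"
        using z(1) r by (intro \<delta>(2)) (auto simp: dist_commute)
      ultimately have "dist 1 (deriv v a) < e + e"
        using dist_triangle[of 1 "deriv v a" "deriv v z"] by linarith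
      then show False by (simp add: e_def dist_norm norm_minus_commute)
    qed
  qed
  moreover have "cball a r \<subseteq> D" using R(2) r by auto
  ultimately show ?thesis using r(1) that by blast
qed

lemma chordal_limit_near_nondegenerate:
  assumes a: "a \<in> D" "v a \<noteq> 0 \<or> u a \<noteq> 0"
  shows "chordal_limit_near a"
proof -
  have "{z \<in> D. v z \<noteq> 0 \<or> u z \<noteq> 0} = {z \<in> D. v z \<noteq> 0} \<union> {z \<in> D. u z \<noteq> 0}" by blast
  moreover have "open {z \<in> D. v z \<noteq> 0}" "open {z \<in> D. u z \<noteq> 0}"
    using u_holo v_holo open_D by (auto intro: open_nonzero_set)
  ultimately have "open {z \<in> D. v z \<noteq> 0 \<or> u z \<noteq> 0}" by auto
  then obtain r where r: "r > 0" "cball a r \<subseteq> {z \<in> D. v z \<noteq> 0 \<or> u z \<noteq> 0}"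
    using small_cball[of _ a] a by blast
  have sub: "cball a r \<subseteq> D" using r(2) by blast
  have "uniform_limit (cball a r) (\<lambda>n z. chordal (ratio (inv_log_deriv (s n) z) (inv_deriv (s n) z)) (ratio (v z) (u z)))
      (\<lambda>_. 0) sequentially"
  proof (rule uniform_limit_chordal_ratio)
    show "continuous_on (cball a r) v" "continuous_on (cball a r) u"
      using u_holo v_holo sub by (auto intro: holomorphic_on_imp_continuous_on holomorphic_on_subset)
  qed (use r u_lim v_lim sub in auto)
  moreover have "uniform_limit (cball a r) (\<lambda>n z. chordal (ratio (inv_log_deriv (s n) z) (inv_deriv (s n) z)) (ratio (v z) (u z)))
      (\<lambda>_. 0) sequentially \<longleftrightarrow> uniform_limit (cball a r)
     (\<lambda>n z. chordal (to_sphere (s n) z) (ratio (v z) (u z))) (\<lambda>_. 0) sequentially"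
    using sub critical_free.to_sphere_eq_ratio[OF critical_free] by (intro uniform_limit_cong') auto
  ultimately show ?thesis unfolding chordal_limit_near_def using r(1) by blast
qed

text \<open>
  Where the \<open>s n\<close> have no zeros, \<open>[1 : 1 / s n]\<close> are coordinates without common zeros, so that
  convergence of the reciprocals suffices, whatever the limits of the original coordinates.
\<close>
lemma chordal_limit_near_of_recip:
  assumes r: "r > 0" "cball a r \<subseteq> D"
    and zero_free: "\<forall>\<^sub>F n in sequentially. \<forall>z\<in>cball a r. \<not> is_pole (s n) z \<longrightarrow> s n z \<noteq> 0"
    and lim: "uniform_limit (cball a r) (\<lambda>n. recip (s n)) w sequentially"
    and w: "continuous_on (cball a r) w" "\<And>z. z \<in> cball a r \<Longrightarrow> ratio (v z) (u z) = ratio 1 (w z)"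
  shows "chordal_limit_near a"
proof -
  have "uniform_limit (cball a r) (\<lambda>n z. chordal (ratio 1 (recip (s n) z)) (ratio 1 (w z))) (\<lambda>_. 0) sequentially"
    by (rule uniform_limit_chordal_ratio[OF _ _ w(1) _ _ lim]) (auto intro: uniform_limit_const)
  moreover have "\<forall>\<^sub>F n in sequentially. \<forall>z\<in>cball a r. chordal (ratio 1 (recip (s n) z)) (ratio 1 (w z)) =
      chordal (to_sphere (s n) z) (ratio (v z) (u z))"
    using zero_free
  proof eventually_elim
    case (elim n)
    show ?case
    proof
      fix z assume "z \<in> cball a r"
      then show "chordal (ratio 1 (recip (s n) z)) (ratio 1 (w z)) =
          chordal (to_sphere (s n) z) (ratio (v z) (u z))"
        using elim w(2) by (auto simp: recip_def to_sphere_def ratio_def)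
    qed
  qed
  ultimately have "uniform_limit (cball a r)
     (\<lambda>n z. chordal (to_sphere (s n) z) (ratio (v z) (u z))) (\<lambda>_. 0) sequentially"
    by (subst (asm) uniform_limit_cong) auto
  then show ?thesis unfolding chordal_limit_near_def using r(1) by blast
qed

text \<open>
  Here \<open>deriv v a \<noteq> 1\<close>, so that \<open>s n\<close> has no zeros near \<open>a\<close> and \<open>1 / s n\<close> is holomorphic there. On a small
  circle around \<open>a\<close> it converges to \<open>u / v\<close>, and by the maximum principle it then converges in the
  disc to the holomorphic extension of \<open>u / v\<close>.
\<close>
lemma chordal_limit_near_zero_of_u:
  assumes a: "a \<in> D" "u a = 0" and nz: "\<exists>z\<in>D. u z \<noteq> 0"
  shows "chordal_limit_near a"
proof -
  obtain r1 w where r1: "r1 > 0" "ball a r1 \<subseteq> D" "w holomorphic_on ball a r1" "deriv v a \<noteq> 1" "w a = 0"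
     "\<And>z. z \<in> ball a r1 - {a} \<Longrightarrow> v z \<noteq> 0 \<and> w z = u z / v z \<and> u z \<noteq> 0"
    using wronskian_solution_at_zero[OF u_holo v_holo open_D connected_D a nz wronskian_limit] by metis
  obtain r2 where r2: "r2 > 0" "cball a r2 \<subseteq> D"
      "\<forall>\<^sub>F n in sequentially. \<forall>z\<in>cball a r2. \<not> is_pole (s n) z \<longrightarrow> s n z \<noteq> 0"
    using eventually_zero_free[OF a(1) r1(4)] .
  define R where "R = min r1 r2"
  define r where "r = R / 2"
  have r: "0 < r" "r < R" "R \<le> r1" "R \<le> r2" using r1(1) r2(1) by (auto simp: R_def r_def)
  have sub: "ball a R \<subseteq> ball a r1" "ball a R \<subseteq> cball a r2" "cball a r \<subseteq> ball a R" "sphere a r \<subseteq> ball a r1 - {a}"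
    using r by auto
  have sphD: "sphere a r \<subseteq> D" using sub(4) r1(2) by blast
  have v0: "v z \<noteq> 0" if "z \<in> sphere a r" for z using sub(4) r1(6) that by blast
  have contD: "continuous_on (sphere a r) u" "continuous_on (sphere a r) v"
    using u_holo v_holo sphD by (auto intro: holomorphic_on_imp_continuous_on holomorphic_on_subset)
  obtain b where b: "b > 0" "\<And>z. z \<in> sphere a r \<Longrightarrow> b \<le> norm (v z)"
  proof -
    have "sphere a r \<noteq> {}" using r by auto
    moreover have "continuous_on (sphere a r) (\<lambda>z. norm (v z))" using contD by (intro continuous_intros)
    ultimately obtain z0 where "z0 \<in> sphere a r" "\<And>z. z \<in> sphere a r \<Longrightarrow> norm (v z0) \<le> norm (v z)"
      using continuous_attains_inf[OF compact_sphere] by metis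
    then show ?thesis using v0 by (intro that[of "norm (v z0)"]) auto
  qed
  have "uniform_limit (sphere a r) (\<lambda>n z. inv_deriv (s n) z / inv_log_deriv (s n) z) (\<lambda>z. u z / v z) sequentially"
    using sphD contD b
    by (intro uniform_lim_divide u_lim v_lim compact_imp_bounded compact_continuous_image) auto
  moreover have "\<forall>\<^sub>F n in sequentially. \<forall>z\<in>sphere a r. inv_deriv (s n) z / inv_log_deriv (s n) z = recip (s n) z"
    using r2(3)
  proof eventually_elim
    case (elim n)
    show ?case
    proof
      fix z assume z: "z \<in> sphere a r"
      then show "inv_deriv (s n) z / inv_log_deriv (s n) z = recip (s n) z"
        using critical_free.recip_eq_divide[OF critical_free subsetD[OF sphD z]] by simp
    qed
  qed
  ultimately have sph: "uniform_limit (sphere a r) (\<lambda>n. recip (s n)) w sequentially"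
  proof (subst (asm) uniform_limit_cong)
    show "u z / v z = w z" if "z \<in> sphere a r" for z
      using r1(6) subsetD[OF sub(4) that] by simp
  qed
  have cb: "uniform_limit (cball a r) (\<lambda>n. recip (s n)) w sequentially"
  proof (rule uniform_limit_sphere_imp_cball[OF r(1,2) _ _ sph])
    show "\<forall>\<^sub>F n in sequentially. recip (s n) holomorphic_on ball a R"
      using r2(3)
    proof eventually_elim
      case (elim n)
      show ?case
        by (rule critical_free.recip_holomorphic[OF critical_free]) (use elim sub r1(2) in auto)
    qed
    show "w holomorphic_on ball a R" using r1(3) sub(1) by (rule holomorphic_on_subset)
  qed
  show ?thesis
  proof (rule chordal_limit_near_of_recip[OF r(1) _ _ cb])
    show "cball a r \<subseteq> D" using sub r1(2) by blast
    show "\<forall>\<^sub>F n in sequentially. \<forall>z\<in>cball a r. \<not> is_pole (s n) z \<longrightarrow> s n z \<noteq> 0"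
      using r2(3) by eventually_elim (use sub in blast)
    show "continuous_on (cball a r) w"
      using r1(3) sub by (intro holomorphic_on_imp_continuous_on) (auto elim!: holomorphic_on_subset)
    show "ratio (v z) (u z) = ratio 1 (w z)" if "z \<in> cball a r" for z
    proof (cases "z = a")
      case False
      then have "z \<in> ball a r1 - {a}" using subsetD[OF sub(1) subsetD[OF sub(3) that]] by simp
      then show ?thesis using r1(6)[of z] by (auto simp: ratio_def)
    qed (use a r1(5) in \<open>simp add: ratio_def\<close>)
  qed
qed

text \<open>
  Since \<open>deriv v = 0\<close>, again \<open>s n\<close> has no zeros near \<open>a\<close>. As \<open>inv_deriv (s n)\<close> tends to \<open>0\<close>, the
  reciprocals satisfy Riccati inequalities with constants \<open>1 / \<eta>\<close> tending to infinity. Hence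
  they tend to \<open>0\<close>, and \<open>s n\<close> tends to \<open>\<infinity>\<close>.
\<close>
lemma chordal_limit_near_trivial:
  assumes a: "a \<in> D" and zero: "\<And>z. z \<in> D \<Longrightarrow> u z = 0" "\<And>z. z \<in> D \<Longrightarrow> v z = 0"
  shows "chordal_limit_near a"
proof -
  have "deriv v a = deriv (\<lambda>_. 0) a"
    using eventually_nhds_in_open[OF open_D a] zero(2)
    by (intro deriv_cong_ev) (auto elim: eventually_mono)
  then have "deriv v a \<noteq> 1" by simp
  from eventually_zero_free[OF a this]
  obtain R where R: "R > 0" "cball a R \<subseteq> D"
      "\<forall>\<^sub>F n in sequentially. \<forall>z\<in>cball a R. \<not> is_pole (s n) z \<longrightarrow> s n z \<noteq> 0" .
  define r where "r = R / 2"
  have r: "r > 0" "r < R" using R(1) by (auto simp: r_def)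
  have near: "ball z r \<subseteq> ball a R" if "z \<in> cball a r" for z
  proof
    fix x assume "x \<in> ball z r"
    then show "x \<in> ball a R" using that dist_triangle[of a x z] by (simp add: r_def)
  qed
  have lim: "uniform_limit (cball a r) (\<lambda>n. recip (s n)) (\<lambda>_. 0) sequentially"
  proof (rule uniform_limitI)
    fix e :: real assume e: "e > 0"
    define \<eta> where "\<eta> = e * r / 2"
    have \<eta>: "\<eta> > 0" using e r by (simp add: \<eta>_def)
    have "\<forall>\<^sub>F n in sequentially. \<forall>z\<in>cball a R. dist (inv_deriv (s n) z) (u z) < \<eta>"
      using u_lim[OF compact_cball R(2)] \<eta> by (rule uniform_limitD)
    then show "\<forall>\<^sub>F n in sequentially. \<forall>z\<in>cball a r. dist (recip (s n) z) 0 < e"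
      using R(3)
    proof eventually_elim
      case (elim n)
      have ballD: "ball a R \<subseteq> D" using R(2) ball_subset_cball by blast
      have zf: "\<And>z. z \<in> ball a R \<Longrightarrow> \<not> is_pole (s n) z \<Longrightarrow> s n z \<noteq> 0" using elim(2) by auto
      have holo: "recip (s n) holomorphic_on ball a R"
        by (rule critical_free.recip_holomorphic[OF critical_free open_ball ballD zf])
      have ric: "norm (deriv (recip (s n)) z) \<ge> (1 / \<eta>) * (norm (recip (s n) z))\<^sup>2" if z: "z \<in> ball a R" for z
      proof -
        have "u z = 0" using z ballD zero by blast
        then have small: "norm (inv_deriv (s n) z) \<le> \<eta>" using bspec[OF elim(1), of z] z by (simp add: dist_norm)
        have "(norm (recip (s n) z))\<^sup>2 = norm (deriv (recip (s n)) z * inv_deriv (s n) z)"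
          using critical_free.deriv_recip[OF critical_free open_ball ballD zf z] by (simp add: norm_power)
        also have "\<dots> \<le> norm (deriv (recip (s n)) z) * \<eta>"
          unfolding norm_mult using small by (rule mult_left_mono) simp
        finally show ?thesis using \<eta> by (simp add: field_simps)
      qed
      show ?case
      proof
        fix z assume z: "z \<in> cball a r"
        have "norm (recip (s n) z) \<le> 1 / ((1 / \<eta>) * r)"
          using near[OF z] ric \<eta> r holo
          by (intro norm_le_of_Riccati_inequality) (auto elim!: holomorphic_on_subset)
        also have "\<dots> = e / 2" using r by (simp add: \<eta>_def)
        finally show "dist (recip (s n) z) 0 < e" using e by simp
      qed
    qed
  qed
  have sub: "cball a r \<subseteq> cball a R" using r by auto
  show ?thesis
  proof (rule chordal_limit_near_of_recip[OF r(1) _ _ lim])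
    show "\<forall>\<^sub>F n in sequentially. \<forall>z\<in>cball a r. \<not> is_pole (s n) z \<longrightarrow> s n z \<noteq> 0"
      using R(3) by eventually_elim (use sub in blast)
    show "ratio (v z) (u z) = ratio 1 0" if "z \<in> cball a r" for z
      using zero(1)[of z] subsetD[OF R(2) subsetD[OF sub that]] by (simp add: ratio_def)
  qed (use sub R(2) in auto)
qed

lemma chordally_convergent:
  assumes "U \<subseteq> D" "\<And>a. a \<in> U \<Longrightarrow> chordal_limit_near a"
  shows "chordally_convergent_on U s"
  using assms(2) unfolding chordal_limit_near_def by (rule chordally_convergent_onI)

lemma chordally_convergent_on_domain:
  assumes "(\<exists>z\<in>D. u z \<noteq> 0) \<or> (\<forall>z\<in>D. v z = 0)"
  shows "chordally_convergent_on D s"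
proof (rule chordally_convergent)
  fix a assume a: "a \<in> D"
  show "chordal_limit_near a"
    using chordal_limit_near_nondegenerate[OF a] chordal_limit_near_zero_of_u[OF a]
      chordal_limit_near_trivial[OF a] assms by blast
qed auto

lemma chordally_convergent_off_discrete:
  "\<exists>E\<subseteq>D. (\<forall>z\<in>D. \<not> z islimpt E) \<and> chordally_convergent_on (D - E) s"
proof (cases "(\<exists>z\<in>D. u z \<noteq> 0) \<or> (\<forall>z\<in>D. v z = 0)")
  case True
  then show ?thesis
    using chordally_convergent_on_domain by (intro exI[of _ "{}"]) auto
next
  case False
  then obtain b where b: "b \<in> D" "v b \<noteq> 0" by blast
  define E where "E = {z \<in> D. v z = 0}"
  have "\<not> z islimpt E" if "z \<in> D" for z
  proof
    assume lim: "z islimpt E"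
    have "E \<subseteq> D" "\<And>x. x \<in> E \<Longrightarrow> v x = 0" by (auto simp: E_def)
    then have "v b = 0"
      by (intro analytic_continuation[OF v_holo open_D connected_D _ that lim _ b(1)])
    with b show False by simp
  qed
  moreover have "chordally_convergent_on (D - E) s"
    by (rule chordally_convergent) (auto simp: E_def intro: chordal_limit_near_nondegenerate)
  moreover have "E \<subseteq> D" by (auto simp: E_def)
  ultimately show ?thesis by blast
qed

end

section \<open>Normality and quasi-normality\<close>

text \<open>Montel's theorem, applied to the two bounded coordinates in turn.\<close>

lemma convergent_pair_subsequence:
  fixes s :: "nat \<Rightarrow> complex \<Rightarrow> complex"
  assumes "complex_domain D" "C > 0" "\<alpha> \<ge> 1" and s: "range s \<subseteq> deriv_family \<alpha> C D"
  obtains r u v where "strict_mono r" "convergent_pair D (s \<circ> r) u v"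
proof -
  have D: "open D" "connected D" using assms(1) by (auto simp: complex_domain_def)
  have s': "s n \<in> deriv_family \<alpha> C D" for n using s by auto
  note fam = D(1) assms(2,3)
  define H where "H = {h. h holomorphic_on D \<and> (\<forall>z\<in>D. norm (h z) \<le> 2 / C)}"
  have H: "\<And>h. h \<in> H \<Longrightarrow> h holomorphic_on D"
    "\<And>K. compact K \<Longrightarrow> K \<subseteq> D \<Longrightarrow> \<exists>B. \<forall>h\<in>H. \<forall>z\<in>K. norm (h z) \<le> B"
    by (auto simp: H_def)
  have cf: "critical_free (s n) D" for n using deriv_family_critical_free[OF s' fam] .
  have rng1: "range (\<lambda>n. inv_deriv (s n)) \<subseteq> H"
    using inv_deriv_bound[OF s' fam] critical_free.inv_deriv_holomorphic[OF cf] by (auto simp: H_def)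
  obtain u r1 where u: "u holomorphic_on D" "strict_mono r1"
    "\<And>K. compact K \<Longrightarrow> K \<subseteq> D \<Longrightarrow> uniform_limit K ((\<lambda>n. inv_deriv (s n)) \<circ> r1) u sequentially"
    by (rule Montel[OF D(1) _ _ rng1]) (use H in blast)+
  have rng2: "range (\<lambda>n. inv_log_deriv (s (r1 n))) \<subseteq> H"
    using inv_log_deriv_bound[OF s' fam] critical_free.inv_log_deriv_holomorphic[OF cf] by (auto simp: H_def)
  obtain v r2 where v: "v holomorphic_on D" "strict_mono (r2 :: nat \<Rightarrow> nat)"
    "\<And>K. compact K \<Longrightarrow> K \<subseteq> D \<Longrightarrow> uniform_limit K ((\<lambda>n. inv_log_deriv (s (r1 n))) \<circ> r2) v sequentially"
    by (rule Montel[OF D(1) _ _ rng2]) (use H in blast)+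
  show ?thesis
  proof (rule that[of "r1 \<circ> r2" u v])
    show "strict_mono (r1 \<circ> r2)" using u(2) v(2) by (rule strict_mono_o)
    show "convergent_pair D (s \<circ> (r1 \<circ> r2)) u v"
    proof (rule convergent_pair.intro)
      fix K assume K: "compact K" "K \<subseteq> D"
      show "uniform_limit K (\<lambda>n. inv_deriv ((s \<circ> (r1 \<circ> r2)) n)) u sequentially"
        using filterlim_compose[OF u(3)[OF K] filterlim_subseq[OF v(2)]] by (simp add: o_def)
      show "uniform_limit K (\<lambda>n. inv_log_deriv ((s \<circ> (r1 \<circ> r2)) n)) v sequentially"
        using v(3)[OF K] by (simp add: o_def)
    qed (use D cf u(1) v(1) in auto)
  qed
qed

lemma quasi_normal_deriv_family:
  assumes "complex_domain D" "C > 0" "\<alpha> \<ge> 1"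
  shows "quasi_normal_family (deriv_family \<alpha> C D) D"
  unfolding quasi_normal_family_def
proof (intro allI impI)
  fix s :: "nat \<Rightarrow> complex \<Rightarrow> complex" assume "range s \<subseteq> deriv_family \<alpha> C D"
  from convergent_pair_subsequence[OF assms this]
  obtain r u v where r: "strict_mono r" "convergent_pair D (s \<circ> r) u v" .
  from convergent_pair.chordally_convergent_off_discrete[OF r(2)] r(1)
  show "\<exists>r E. strict_mono r \<and> E \<subseteq> D \<and> (\<forall>z\<in>D. \<not> z islimpt E) \<and> chordally_convergent_on (D - E) (s \<circ> r)"
    by blast
qed

text \<open>
  In the limit the estimate for \<open>\<alpha> > 1\<close> becomes \<open>|v| powr \<alpha> \<le> |u| powr (\<alpha> - 1) / C\<close>. So \<open>v\<close> vanishes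
  identically as soon as \<open>u\<close> does, and no exceptional points arise.
\<close>
lemma normal_deriv_family:
  assumes "complex_domain D" "C > 0" "\<alpha> > 1"
  shows "normal_family (deriv_family \<alpha> C D) D"
  unfolding normal_family_def
proof (intro allI impI)
  fix s :: "nat \<Rightarrow> complex \<Rightarrow> complex" assume s: "range s \<subseteq> deriv_family \<alpha> C D"
  have D: "open D" using assms(1) by (simp add: complex_domain_def)
  have \<alpha>: "\<alpha> \<ge> 1" using assms(3) by simp
  from convergent_pair_subsequence[OF assms(1,2) \<alpha> s]
  obtain r u v where r: "strict_mono r" "convergent_pair D (s \<circ> r) u v" .
  interpret convergent_pair D "s \<circ> r" u v by fact
  have "v z = 0" if z: "z \<in> D" "u z = 0" for z
  proof -
    have "(\<lambda>n. inv_deriv (s (r n)) z) \<longlonglongrightarrow> u z" "(\<lambda>n. inv_log_deriv (s (r n)) z) \<longlonglongrightarrow> v z"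
      using u_lim[of "{z}"] v_lim[of "{z}"] z(1) by (auto simp: o_def)
    then have "(\<lambda>n. norm (inv_log_deriv (s (r n)) z) powr \<alpha>) \<longlonglongrightarrow> norm (v z) powr \<alpha>"
      and "(\<lambda>n. norm (inv_deriv (s (r n)) z) powr (\<alpha> - 1) / C) \<longlonglongrightarrow> norm (u z) powr (\<alpha> - 1) / C"
      using assms(2,3) by (auto intro!: tendsto_intros tendsto_powr')
    moreover have "norm (inv_log_deriv (s (r n)) z) powr \<alpha> \<le> norm (inv_deriv (s (r n)) z) powr (\<alpha> - 1) / C" for n
      using s by (intro inv_log_deriv_le_inv_deriv[OF _ D assms(2) \<alpha> z(1)]) auto
    ultimately have "norm (v z) powr \<alpha> \<le> norm (u z) powr (\<alpha> - 1) / C"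
      by (intro LIMSEQ_le) auto
    then have "norm (v z) powr \<alpha> = 0" using z(2) powr_ge_zero[of "norm (v z)" \<alpha>] by simp
    then show ?thesis by simp
  qed
  then have "chordally_convergent_on D (s \<circ> r)"
    by (intro chordally_convergent_on_domain) blast
  with r(1) show "\<exists>r. strict_mono r \<and> chordally_convergent_on D (s \<circ> r)" by blast
qed

section \<open>Failure of normality in the linear case\<close>

text \<open>
  On the unit disc \<open>n / (1 + |n z|) > n / (1 + n)\<close> for \<open>n \<ge> 1\<close>, which is at least \<open>1 / 2\<close>.
\<close>

lemma dilation_in_deriv_family:
  "(\<lambda>z. of_nat (Suc n) * z) \<in> deriv_family 1 (1 / 3) (ball 0 1)"
proof -
  define f :: "complex \<Rightarrow> complex" where "f z = of_nat (Suc n) * z" for z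
  have holo: "f holomorphic_on UNIV" unfolding f_def by (intro holomorphic_intros)
  have no_pole: "\<not> is_pole f z" for z by (rule not_is_pole_holomorphic[OF open_UNIV UNIV_I holo])
  have "f analytic_on ball 0 1" using holo by (meson analytic_on_open analytic_on_subset open_UNIV subset_UNIV)
  then have "f nicely_meromorphic_on ball 0 1" by (rule analytic_on_imp_nicely_meromorphic_on)
  moreover have "deriv_quotient 1 f z > 1 / 3" if "z \<in> ball 0 1" for z
  proof -
    have "(f has_field_derivative of_nat (Suc n)) (at z)"
      unfolding f_def by (auto intro!: derivative_eq_intros)
    then have d: "deriv f z = of_nat (Suc n)" by (rule DERIV_imp_deriv)
    have "real (Suc n) * norm z \<le> real (Suc n) * 1" using that by (intro mult_left_mono) auto
    then have "norm (f z) \<le> real (Suc n)" by (simp add: f_def norm_mult del: of_nat_Suc)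
    then have "1 + norm (f z) < 3 * real (Suc n)" by simp
    moreover have "1 + norm (f z) > 0" by (simp add: add_pos_nonneg)
    ultimately show ?thesis
      by (simp add: deriv_quotient_def d divide_simps del: of_nat_Suc)
  qed
  ultimately have "f \<in> deriv_family 1 (1 / 3) (ball 0 1)"
    by (auto simp: deriv_family_def ext_deriv_quotient_def no_pole)
  then show ?thesis by (simp add: f_def[abs_def])
qed

text \<open>
  In homogeneous coordinates \<open>l n * z\<close> is \<open>[z : 1 / l n]\<close>, so that its chordal distance from a finite
  point \<open>w = [w : 1]\<close> tends to that of \<open>[z : 0]\<close>, which is positive.
\<close>
lemma dilations_chordal_limit:
  assumes z: "z \<noteq> 0" and l: "filterlim l at_top sequentially"
    and lim: "(\<lambda>n. chordal (Some (of_real (l n) * z)) p) \<longlonglongrightarrow> 0"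
  shows "p = None"
proof (cases p)
  case (Some w)
  have e: "(\<lambda>n. 1 / complex_of_real (l n)) \<longlonglongrightarrow> 0"
  proof -
    have "(\<lambda>n. 1 / l n) \<longlonglongrightarrow> 0" using l by (intro tendsto_divide_0[OF tendsto_const] filterlim_at_top_imp_at_infinity)
    from tendsto_of_real[OF this, where 'a = complex] show ?thesis by simp
  qed
  define c where "c n = norm (z * 1 - w * (1 / complex_of_real (l n))) /
    (sqrt ((norm z)\<^sup>2 + (norm (1 / complex_of_real (l n)))\<^sup>2) * sqrt ((norm w)\<^sup>2 + (norm (1::complex))\<^sup>2))" for n
  have "\<forall>\<^sub>F n in sequentially. l n > 0" using l by (simp add: filterlim_at_top_dense)
  then have "\<forall>\<^sub>F n in sequentially. chordal (Some (of_real (l n) * z)) p = c n"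
  proof eventually_elim
    case (elim n)
    have "Some (of_real (l n) * z) = ratio z (1 / of_real (l n))" "p = ratio w 1"
      using elim by (auto simp: ratio_def Some)
    then show ?case unfolding c_def using z by (simp only:) (rule chordal_ratio, auto)
  qed
  with lim have "c \<longlonglongrightarrow> 0" by (simp add: tendsto_cong)
  moreover have "c \<longlonglongrightarrow> norm (z * 1 - w * 0) / (sqrt ((norm z)\<^sup>2 + (norm (0::complex))\<^sup>2) * sqrt ((norm w)\<^sup>2 + (norm (1::complex))\<^sup>2))"
  proof -
    have "1 + (norm w)\<^sup>2 > 0" by (simp add: add_pos_nonneg)
    then show ?thesis
      unfolding c_def[abs_def] by (intro tendsto_intros e) (use z in \<open>auto simp: add.commute\<close>)
  qed
  ultimately have "norm (z * 1 - w * 0) / (sqrt ((norm z)\<^sup>2 + (norm (0::complex))\<^sup>2) * sqrt ((norm w)\<^sup>2 + (norm (1::complex))\<^sup>2)) = 0"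
    by (rule LIMSEQ_unique[symmetric])
  then have "(norm w)\<^sup>2 + 1 = 0" using z by simp
  then have False by (smt (verit) zero_le_power2)
  then show ?thesis ..
qed

text \<open>
  A subsequence of \<open>\<lambda>z. n * z\<close> can only converge to \<open>\<infinity>\<close> off the origin. Convergence
  is not uniform there, since the member with factor \<open>l n\<close> takes the value \<open>1 / 2\<close> at \<open>1 / (2 * l n)\<close>.
\<close>
lemma not_normal_deriv_family_1: "\<not> normal_family (deriv_family 1 (1 / 3) (ball 0 1)) (ball 0 1)"
proof
  define s :: "nat \<Rightarrow> complex \<Rightarrow> complex" where "s n z = of_nat (Suc n) * z" for n z
  assume "normal_family (deriv_family 1 (1 / 3) (ball 0 1)) (ball 0 1)"
  moreover have "range s \<subseteq> deriv_family 1 (1 / 3) (ball 0 1)"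
    using dilation_in_deriv_family by (auto simp: s_def[abs_def])
  ultimately obtain r where r: "strict_mono r" "chordally_convergent_on (ball 0 1) (s \<circ> r)"
    unfolding normal_family_def by blast
  define l where "l n = real (Suc (r n))" for n
  have "s n holomorphic_on UNIV" for n
    unfolding s_def[abs_def] by (intro holomorphic_intros)
  then have "\<not> is_pole (s n) z" for n z
    by (intro not_is_pole_holomorphic[of UNIV]) auto
  then have sph: "to_sphere ((s \<circ> r) n) z = Some (of_real (l n) * z)" for n z
    by (simp add: to_sphere_def l_def) (simp add: s_def)
  define K where "K = cball (0::complex) (1 / 2)"
  obtain g where "uniform_limit K (\<lambda>n z. chordal (to_sphere ((s \<circ> r) n) z) (g z)) (\<lambda>_. 0) sequentially"
  proof -
    have "compact K \<and> K \<subseteq> ball 0 1" by (auto simp: K_def)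
    then show ?thesis using r(2) that unfolding chordally_convergent_on_def by blast
  qed
  then have lim: "uniform_limit K (\<lambda>n z. chordal (Some (of_real (l n) * z)) (g z)) (\<lambda>_. 0) sequentially"
    by (simp only: sph)
  have l_top: "filterlim l at_top sequentially"
    unfolding l_def using r(1)
    by (intro filterlim_compose[OF filterlim_real_sequentially] filterlim_compose[OF filterlim_Suc filterlim_subseq])
  have g: "g z = None" if "z \<in> K" "z \<noteq> 0" for z
    using that(2) l_top tendsto_uniform_limitI[OF lim that(1)] by (rule dilations_chordal_limit)
  have "\<forall>\<^sub>F n in sequentially. \<forall>z\<in>K. dist (chordal (Some (of_real (l n) * z)) (g z)) 0 < 1 / 2"
    using lim by (rule uniform_limitD) simp
  then obtain n where n: "\<And>z. z \<in> K \<Longrightarrow> dist (chordal (Some (of_real (l n) * z)) (g z)) 0 < 1 / 2"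
    by (metis (no_types, lifting) eventually_sequentially order_refl)
  define z where "z = complex_of_real (1 / (2 * l n))"
  have ln: "l n \<ge> 1" by (simp add: l_def)
  have "norm z = 1 / (2 * l n)" unfolding z_def norm_of_real using ln by simp
  moreover have "1 / (2 * l n) \<le> 1 / 2" using ln by (intro divide_left_mono) auto
  ultimately have z: "z \<in> K" "z \<noteq> 0" using ln by (auto simp: K_def)
  have "of_real (l n) * z = of_real (1 / 2)"
    unfolding z_def of_real_mult[symmetric] using ln by simp
  then have "dist (chordal (Some (of_real (1 / 2))) None) 0 < 1 / 2"
    using n[OF z(1)] by (simp only: g[OF z])
  then have "1 / sqrt (1 + (1 / 2)\<^sup>2) < 1 / 2" by (simp add: norm_divide)
  moreover have "sqrt (1 + (1 / 2)\<^sup>2) < 2" by (rule real_less_lsqrt) (auto simp: power2_eq_square)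
  then have "1 / 2 < 1 / sqrt (1 + (1 / 2)\<^sup>2)"
    by (intro divide_strict_left_mono mult_pos_pos) (auto simp: power2_eq_square)
  ultimately show False by linarith
qed

theorem theorem1:
  shows "(\<forall>(\<alpha>::real) (C::real) D. 0 \<le> \<alpha> \<and> C > 0 \<and> complex_domain D \<longrightarrow>
            (\<alpha> > 1 \<longrightarrow> normal_family (deriv_family \<alpha> C D) D) \<and>
            (\<alpha> = 1 \<longrightarrow> quasi_normal_family (deriv_family \<alpha> C D) D)) \<and>
         (\<exists>(C::real) D. C > 0 \<and> complex_domain D \<and> \<not> normal_family (deriv_family 1 C D) D)"
proof
  show "\<exists>(C::real) D. C > 0 \<and> complex_domain D \<and> \<not> normal_family (deriv_family 1 C D) D"
    using not_normal_deriv_family_1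
    by (intro exI[of _ "1 / 3"] exI[of _ "ball 0 1"]) (auto simp: complex_domain_def)
qed (use normal_deriv_family quasi_normal_deriv_family in auto)

end
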